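(* Let $X\subset\mathbb{R}^n$ and $Y\subset\mathbb{R}^m$ be semialgebraic sets. If $h\colon X\to Y$ is a semialgebraic outer lipeomorphism, then $h$ is a blow-spherical homeomorphism.
   Context: An outer lipeomorphism $h\colon X\to Y$ is a bijection such that $h$ and $h^{-1}$ are Lipschitz with respect to the Euclidean distances restricted to $X$ and $Y$. Spherical blow-up: for $p\in\mathbb{R}^{N}$, $\rho_p\colon\mathbb{S}^{N-1}\times[0,\infty)\to\mathbb{R}^{N}$, $\rho_p(x,r)=rx+p$, and $\rho_\infty\colon\mathbb{S}^{N-1}\times(0,\infty)\to\mathbb{R}^{N}$, $\rho_\infty(x,r)=x/r$; $\rho_p^{-1}$ denotes the inverse of the restriction to $r>0$. For $X\subset\mathbb{R}^N$, $X'_p$ is the closure in $\mathbb{S}^{N-1}\times[0,\infty)$ of $\rho_p^{-1}(X\setminus\{p\})$ (of $\rho_\infty^{-1}(X\setminus\{0\})$ if $p=\infty$), and $\partial X'_p=X'_p\cap(\mathbb{S}^{N-1}\times\{0\})$. Let $p\in\overline{X}$, or $p=\infty$ with $X$ unbounded, and $q\in\mathbb{R}^m\cup\{\infty\}$. A homeomorphism $\varphi\colon X\to Y$ with $\lim_{x\to p}\varphi(x)=q$ is a blow-spherical homeomorphism at $p$ if the homeomorphism $\rho_q^{-1}\circ\varphi\circ\rho_p$ from $\rho_p^{-1}(X\setminus\{p\})$ to $\rho_q^{-1}(Y\setminus\{q\})$ (these are $X'_p\setminus\partial X'_p$ and $Y'_q\setminus\partial Y'_q$ for closed sets) extends to a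 homeomorphism $\varphi'\colon X'_p\to Y'_q$; this is understood near the boundary $r=0$, i.e. as an extension to a homeomorphism from a neighbourhood of $\partial X'_p$ in $X'_p$ onto a neighbourhood of $\partial Y'_q$ in $Y'_q$. $\varphi$ is a blow-spherical homeomorphism if it is one at every $p\in\overline X\cup\{\infty\}$ ($\infty$ only when $X$ is unbounded). *)

theory Defs
  imports "HOL-Analysis.Analysis"
begin

inductive semialgebraic :: "'a::euclidean_space set \<Rightarrow> bool" where
  pos: "real_polynomial_function f \<Longrightarrow> semialgebraic {x. f x > 0}"
| Compl: "semialgebraic A \<Longrightarrow> semialgebraic (- A)"
| Un: "semialgebraic A \<Longrightarrow> semialgebraic B \<Longrightarrow> semialgebraic (A \<union> B)"
| Int: "semialgebraic A \<Longrightarrow> semialgebraic B \<Longrightarrow> semialgebraic (A \<inter> B)"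

definition semialgebraic_map_on ::
  "'a::euclidean_space set \<Rightarrow> ('a \<Rightarrow> 'b::euclidean_space) \<Rightarrow> bool" where
  "semialgebraic_map_on X h \<longleftrightarrow> semialgebraic ((\<lambda>x. (x, h x)) ` X)"

definition outer_lipeomorphism ::
  "'a::metric_space set \<Rightarrow> 'b::metric_space set \<Rightarrow> ('a \<Rightarrow> 'b) \<Rightarrow> bool" where
  "outer_lipeomorphism X Y h \<longleftrightarrow>
     bij_betw h X Y \<and> (\<exists>L. L-lipschitz_on X h) \<and> (\<exists>L. L-lipschitz_on Y (the_inv_into X h))"

text \<open>As in the library's one-point compactification, points of
  \<open>\<real>\<^sup>N \<union> {\<infinity>}\<close> are of type \<open>'a option\<close>, with \<open>None\<close> for \<open>\<infinity>\<close>.\<close>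

definition nhds_ext :: "'a::real_normed_vector option \<Rightarrow> 'a filter" where
  "nhds_ext p = (case p of Some a \<Rightarrow> nhds a | None \<Rightarrow> at_infinity)"

definition in_ext_closure :: "'a::real_normed_vector option \<Rightarrow> 'a set \<Rightarrow> bool" where
  "in_ext_closure p X \<longleftrightarrow> (case p of Some a \<Rightarrow> a \<in> closure X | None \<Rightarrow> \<not> bounded X)"

definition sph_blowup :: "'a::real_normed_vector option \<Rightarrow> 'a \<times> real \<Rightarrow> 'a" where
  "sph_blowup p = (\<lambda>(x, r). case p of Some a \<Rightarrow> r *\<^sub>R x + a | None \<Rightarrow> x /\<^sub>R r)"

text \<open>The point missed by the blow-up restricted to \<open>r > 0\<close>; it is the origin for \<open>\<infinity>\<close>.\<close>

definition removed_pt :: "'a::real_normed_vector option \<Rightarrow> 'a" where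
  "removed_pt p = (case p of Some a \<Rightarrow> a | None \<Rightarrow> 0)"

definition sph_blowup_inv :: "'a::real_normed_vector option \<Rightarrow> 'a \<Rightarrow> 'a \<times> real" where
  "sph_blowup_inv p = the_inv_into (sphere 0 1 \<times> {0<..}) (sph_blowup p)"

lemma bij_betw_sph_blowup:
  "bij_betw (sph_blowup p) (sphere 0 1 \<times> {0<..}) (- {removed_pt p})"
proof (cases p)
  case None
  show ?thesis
    by (rule bij_betw_byWitness[where f' = "\<lambda>y. (y /\<^sub>R norm y, inverse (norm y))"])
       (auto simp: None sph_blowup_def removed_pt_def)
next
  case (Some a)
  show ?thesis
    by (rule bij_betw_byWitness[where f' = "\<lambda>y. ((y - a) /\<^sub>R norm (y - a), norm (y - a))"])
       (auto simp: Some sph_blowup_def removed_pt_def)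
qed

text \<open>\<open>strict_part p X\<close> is \<open>\<rho>\<^sub>p\<^sup>-\<^sup>1(X \<setminus> {p})\<close>, \<open>strict_transf p X\<close> is \<open>X'\<^sub>p\<close> and
  \<open>strict_bd p X\<close> is \<open>\<partial>X'\<^sub>p\<close>. The closure may be taken in the whole product space, in which
  \<open>sphere 0 1 \<times> {0..}\<close> is closed.\<close>

definition strict_part :: "'a::real_normed_vector option \<Rightarrow> 'a set \<Rightarrow> ('a \<times> real) set" where
  "strict_part p X = sph_blowup_inv p ` (X - {removed_pt p})"

definition strict_transf :: "'a::real_normed_vector option \<Rightarrow> 'a set \<Rightarrow> ('a \<times> real) set" where
  "strict_transf p X = closure (strict_part p X)"

definition strict_bd :: "'a::real_normed_vector option \<Rightarrow> 'a set \<Rightarrow> ('a \<times> real) set" where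
  "strict_bd p X = strict_transf p X \<inter> (sphere 0 1 \<times> {0})"

text \<open>The limit is taken over all points of \<open>X\<close>, including \<open>p\<close> when \<open>p \<in> X\<close>: it is then
  \<open>\<phi> p\<close>, also for isolated \<open>p\<close>. The homeomorphism \<open>\<phi>'\<close> is only required between open
  neighbourhoods \<open>U\<close> and \<open>V\<close> of the boundaries; away from them \<open>\<phi>\<close> may hit the point
  \<open>removed_pt q\<close>, which matters for \<open>q = \<infinity>\<close>.\<close>

definition blow_spherical_at ::
  "'a::real_normed_vector set \<Rightarrow> 'b::real_normed_vector set \<Rightarrow> ('a \<Rightarrow> 'b) \<Rightarrow>
    'a option \<Rightarrow> 'b option \<Rightarrow> bool" where
  "blow_spherical_at X Y \<phi> p q \<longleftrightarrow>
     (\<exists>\<psi>. homeomorphism X Y \<phi> \<psi>) \<and>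
     in_ext_closure p X \<and>
     filterlim \<phi> (nhds_ext q) (inf (nhds_ext p) (principal X)) \<and>
     (\<exists>U V \<phi>' \<psi>'.
        openin (top_of_set (strict_transf p X)) U \<and> strict_bd p X \<subseteq> U \<and>
        openin (top_of_set (strict_transf q Y)) V \<and> strict_bd q Y \<subseteq> V \<and>
        homeomorphism U V \<phi>' \<psi>' \<and>
        \<phi>' ` (U \<inter> strict_part p X) = V \<inter> strict_part q Y \<and>
        (\<forall>z \<in> U \<inter> strict_part p X. \<phi>' z = (sph_blowup_inv q \<circ> \<phi> \<circ> sph_blowup p) z))"

definition blow_spherical_homeomorphism ::
  "'a::real_normed_vector set \<Rightarrow> 'b::real_normed_vector set \<Rightarrow> ('a \<Rightarrow> 'b) \<Rightarrow> bool" where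
  "blow_spherical_homeomorphism X Y \<phi> \<longleftrightarrow>
     (\<exists>\<psi>. homeomorphism X Y \<phi> \<psi>) \<and>
     (\<forall>p. in_ext_closure p X \<longrightarrow> (\<exists>q. blow_spherical_at X Y \<phi> p q))"

end

theory Submission
  imports Defs
begin

text \<open>
  Fix \<open>p\<close> and let \<open>q\<close> be the limit of \<open>h\<close> at \<open>p\<close>. In blow-up coordinates \<open>h\<close> is governed by the rescaled
  map \<open>H\<close>, which is \<open>(h (r x + a) - b) / r\<close> for finite \<open>p = a\<close>, \<open>q = b\<close> and \<open>r h (x / r)\<close> at infinity: where \<open>H\<close> does not
  vanish, \<open>\<rho>\<^sub>q\<^sup>-\<^sup>1 \<circ> h \<circ> \<rho>\<^sub>p\<close> sends \<open>(x, r)\<close> to the direction \<open>H / |H|\<close> and the radius \<open>r |H|\<close> (or \<open>r / |H|\<close> at infinity).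
  It suffices that \<open>H\<close>, and likewise the rescaled inverse, extends continuously to the closure of
  the strict part: its limits at the boundary do not vanish because the inverse is Lipschitz
  (\<open>rescaled_map_boundary_nonzero\<close>), and then the two extensions induce inverse homeomorphisms of
  neighbourhoods of the boundaries (\<open>blowup_homeomorphism\<close>).

  At positive radius \<open>H\<close> extends because \<open>h\<close> extends to the closure of \<open>X\<close>. At a boundary point \<open>(v, 0)\<close>, \<open>H\<close> is
  bounded, so it has to be shown that it has only one cluster point
  (\<open>rescaled_map_boundary_limit\<close>). If \<open>w\<close> is a cluster point, then \<open>(v, w)\<close> is a tangent direction
  of the graph of \<open>h\<close> at \<open>(p, q)\<close>. Tameness enters here: for each \<open>\<epsilon>\<close>, the set of scales \<open>t\<close> at which the
  graph rescaled by \<open>t\<close> meets the \<open>\<epsilon>\<close>-ball about \<open>(v, w)\<close> is the projection of a semialgebraic set to the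
  line. It therefore contains or misses an interval \<open>(0, \<delta>)\<close>, and as it has arbitrarily small
  elements, it contains one. Given a second cluster point \<open>w'\<close>, there are points of the graph near
  \<open>(v, w)\<close> and near \<open>(v, w')\<close> at the same scale, and the Lipschitz condition yields \<open>w = w'\<close>.

  The statement on projections (\<open>semialgebraic_fst_eventually\<close>) is proved by quantifier
  elimination after Cohen and Hoermander. In place of formulas, the elimination shows that the sign
  vectors which a finite family of polynomials in one variable realises on the real line are
  determined by the signs of finitely many polynomial expressions in the coefficients
  (\<open>sign_determined_finite\<close>). By Thom's lemma, the sign vectors of a family closed under
  differentiation also determine the order in which they occur (\<open>same_signs_less\<close>). Hence a
  polynomial can be adjoined to such a family as soon as its signs at the roots of the family are known
  (\<open>sign_step.extend\<close>), and these are the signs of remainders of lower degree.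
\<close>

section \<open>Sign vectors of real polynomials in one variable\<close>

lemma poly_mono_on_interval:
  fixes p :: "real poly"
  assumes "s \<le> t" "\<And>r. s \<le> r \<Longrightarrow> r \<le> t \<Longrightarrow> poly (pderiv p) r \<ge> 0"
  shows "poly p s \<le> poly p t"
  by (rule DERIV_nonneg_imp_nondecreasing[OF assms(1)]) (use assms(2) poly_DERIV in blast)

lemma poly_strict_mono_on_interval:
  fixes p :: "real poly"
  assumes "s < t" "\<And>r. s < r \<Longrightarrow> r < t \<Longrightarrow> poly (pderiv p) r > 0"
  shows "poly p s < poly p t"
  using poly_MVT[OF assms(1), of p] assms by (metis diff_gt_0_iff_gt mult_pos_pos)

lemma sgn_mono_real: "(x::real) \<le> y \<Longrightarrow> sgn x \<le> sgn y"
  by (auto simp: sgn_if)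

lemma sgn_pos_iff: "sgn (x::real) = sgn y \<Longrightarrow> x > 0 \<longleftrightarrow> y > 0"
  by (auto simp: sgn_if split: if_splits)

lemma sgn_eq_zero_iff: "sgn (x::real) = sgn y \<Longrightarrow> x = 0 \<longleftrightarrow> y = 0"
  by (auto simp: sgn_if split: if_splits)

text \<open>Thom's lemma: the set of points at which a polynomial and all its derivatives have
  prescribed signs is convex.\<close>

lemma poly_sgn_between:
  fixes p :: "real poly"
  assumes "\<And>k. sgn (poly ((pderiv ^^ k) p) s) = sgn (poly ((pderiv ^^ k) p) t)"
    and "s \<le> r" "r \<le> t"
  shows "sgn (poly p r) = sgn (poly p s)"
  using assms
proof (induction "degree p" arbitrary: p r rule: less_induct)
  case less
  show ?case
  proof (cases "degree p = 0")
    case True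
    then show ?thesis by (auto elim!: degree_eq_zeroE)
  next
    case False
    have der: "sgn (poly (pderiv p) u) = sgn (poly (pderiv p) s)" if "s \<le> u" "u \<le> t" for u
    proof (rule less.hyps)
      show "degree (pderiv p) < degree p" using False by (simp add: degree_pderiv)
      show "sgn (poly ((pderiv ^^ k) (pderiv p)) s) = sgn (poly ((pderiv ^^ k) (pderiv p)) t)" for k
        using less.prems(1)[of "Suc k"] by (simp add: funpow_swap1)
    qed (use that in auto)
    have ends: "sgn (poly p s) = sgn (poly p t)" using less.prems(1)[of 0] by simp
    show ?thesis
    proof (cases "poly (pderiv p) s \<ge> 0")
      case True
      then have pos: "poly (pderiv p) u \<ge> 0" if "s \<le> u" "u \<le> t" for u
        using der[OF that] by (auto simp: sgn_if split: if_splits)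
      have "poly p s \<le> poly p r"
        by (rule poly_mono_on_interval) (use less.prems(2,3) pos in auto)
      moreover have "poly p r \<le> poly p t"
        by (rule poly_mono_on_interval) (use less.prems(2,3) pos in auto)
      ultimately show ?thesis using ends sgn_mono_real by (metis order_antisym)
    next
      case False
      then have neg: "poly (pderiv (- p)) u \<ge> 0" if "s \<le> u" "u \<le> t" for u
        using der[OF that] by (auto simp: sgn_if pderiv_minus split: if_splits)
      have "poly (- p) s \<le> poly (- p) r"
        by (rule poly_mono_on_interval) (use less.prems(2,3) neg in auto)
      moreover have "poly (- p) r \<le> poly (- p) t"
        by (rule poly_mono_on_interval) (use less.prems(2,3) neg in auto)
      ultimately show ?thesis using ends sgn_mono_real[of "poly p t" "poly p r"]
          sgn_mono_real[of "poly p r" "poly p s"] by simp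
    qed
  qed
qed

lemma poly_sgn_no_root:
  fixes p :: "real poly"
  assumes "s \<le> t" "\<And>r. s \<le> r \<Longrightarrow> r \<le> t \<Longrightarrow> poly p r \<noteq> 0" "s \<le> r" "r \<le> t"
  shows "sgn (poly p r) = sgn (poly p s)"
proof (rule ccontr)
  assume neq: "sgn (poly p r) \<noteq> sgn (poly p s)"
  then have "s < r" using assms(3) by (cases "s = r") auto
  moreover have "poly p s * poly p r < 0"
    using neq assms(2)[of s] assms(2)[of r] assms(1,3,4)
    by (auto simp: sgn_if mult_less_0_iff split: if_splits)
  ultimately obtain x where "x > s" "x < r" "poly p x = 0"
    using poly_IVT by blast
  then show False using assms(2)[of x] assms by auto
qed

lemma poly_eventually_pos_of_deriv_pos:
  fixes p :: "real poly"
  assumes "\<And>r. r \<ge> t \<Longrightarrow> poly (pderiv p) r > 0"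
  shows "\<exists>r>t. poly p r > 0"
proof -
  have nz: "pderiv p \<noteq> 0" using assms[of t] by auto
  then have d: "degree p \<noteq> 0" by (simp add: pderiv_eq_0_iff)
  have lc: "lead_coeff (pderiv p) = of_nat (degree p) * lead_coeff p"
    using d by (simp add: degree_pderiv coeff_pderiv)
  have "lead_coeff p > 0"
  proof (rule ccontr)
    assume "\<not> lead_coeff p > 0"
    then have "lead_coeff (- pderiv p) > 0"
    proof -
      have "lead_coeff (pderiv p) \<noteq> 0" using nz by simp
      moreover have "lead_coeff (pderiv p) \<le> 0"
        using \<open>\<not> lead_coeff p > 0\<close> unfolding lc by (simp add: mult_nonneg_nonpos)
      ultimately show ?thesis by (simp add: order_less_le del: leading_coeff_0_iff)
    qed
    then obtain n where "\<forall>x\<ge>n. poly (- pderiv p) x \<ge> lead_coeff (- pderiv p)"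
      using poly_pinfty_gt_lc by blast
    then have "poly (- pderiv p) (max n t) > 0"
      using \<open>lead_coeff (- pderiv p) > 0\<close> by (smt (verit) max.cobounded1)
    then show False using assms[of "max n t"] by simp
  qed
  then obtain n where n: "\<forall>x\<ge>n. poly p x \<ge> lead_coeff p"
    using poly_pinfty_gt_lc by blast
  have "poly p (max n (t + 1)) > 0"
    using n \<open>lead_coeff p > 0\<close> by (smt (verit) max.cobounded1)
  then show ?thesis by (intro exI[of _ "max n (t + 1)"]) auto
qed

text \<open>The point \<open>s\<close> has the same sign vector for the family \<open>f\<close> as \<open>t\<close> for the family \<open>g\<close>.\<close>

definition same_signs :: "'i set \<Rightarrow> ('i \<Rightarrow> real poly) \<Rightarrow> ('i \<Rightarrow> real poly) \<Rightarrow> real \<Rightarrow> real \<Rightarrow> bool"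
  where "same_signs I f g s t \<longleftrightarrow> (\<forall>i\<in>I. sgn (poly (f i) s) = sgn (poly (g i) t))"

lemma same_signs_sym: "same_signs I f g s t \<longleftrightarrow> same_signs I g f t s"
  by (auto simp: same_signs_def)

lemma same_signs_subset: "same_signs J f g s t \<Longrightarrow> I \<subseteq> J \<Longrightarrow> same_signs I f g s t"
  unfolding same_signs_def by blast

text \<open>By Thom's lemma, for families closed under differentiation the sign vectors of two points
  already determine the order of these points, unless the two vectors are equal.\<close>

lemma same_signs_less:
  fixes f g :: "'i \<Rightarrow> real poly"
  assumes f: "\<And>i. i \<in> I \<Longrightarrow> f (\<delta> i) = pderiv (f i)" and g: "\<And>i. i \<in> I \<Longrightarrow> g (\<delta> i) = pderiv (g i)"
    and closed: "\<And>i. i \<in> I \<Longrightarrow> \<delta> i \<in> I"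
    and st: "s < t" "same_signs I f g s s'" "same_signs I f g t t'" "\<not> same_signs I f g s t'"
  shows "s' < t'"
proof (rule ccontr)
  assume "\<not> s' < t'"
  then have ts: "t' \<le> s'" by simp
  define D where "D i \<longleftrightarrow> i \<in> I \<and> sgn (poly (f i) s) \<noteq> sgn (poly (f i) t)" for i
  have "\<exists>i. D i"
  proof (rule ccontr)
    assume "\<not> (\<exists>i. D i)"
    then have "same_signs I f g s t'" using st(3) by (simp add: D_def same_signs_def)
    then show False using st(4) by contradiction
  qed
  then obtain i where i: "D i" and min: "\<And>j. D j \<Longrightarrow> degree (f i) \<le> degree (f j)"
    using ex_has_least_nat[of D _ "\<lambda>i. degree (f i)"] by metis
  have iI: "i \<in> I" using i by (simp add: D_def)
  have it: "(\<delta> ^^ k) (\<delta> i) \<in> I \<and> f ((\<delta> ^^ k) (\<delta> i)) = (pderiv ^^ k) (pderiv (f i)) \<and>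
     g ((\<delta> ^^ k) (\<delta> i)) = (pderiv ^^ k) (pderiv (g i))" for k
    by (induction k) (use f g closed iI in auto)
  have "degree (f i) \<noteq> 0"
  proof
    assume "degree (f i) = 0"
    then obtain c where "f i = [:c:]" by (rule degree_eq_zeroE)
    then show False using i by (simp add: D_def)
  qed
  moreover have "degree (f ((\<delta> ^^ k) (\<delta> i))) \<le> degree (f i) - 1" for k
    using it[of k] by (simp add: degree_higher_pderiv degree_pderiv)
  ultimately have "\<not> D ((\<delta> ^^ k) (\<delta> i))" for k
    using min[of "(\<delta> ^^ k) (\<delta> i)"] by (metis One_nat_def Suc_pred le_trans not_less_eq_eq zero_less_iff_neq_zero)
  \<comment> \<open>By minimality, all derivatives of \<open>f i\<close> have equal signs at \<open>s\<close> and \<open>t\<close>.\<close>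
  then have dst: "sgn (poly ((pderiv ^^ k) (pderiv (f i))) s) = sgn (poly ((pderiv ^^ k) (pderiv (f i))) t)" for k
    using it[of k] by (metis D_def)
  have fg: "sgn (poly ((pderiv ^^ k) (pderiv (f i))) s) = sgn (poly ((pderiv ^^ k) (pderiv (g i))) s')"
           "sgn (poly ((pderiv ^^ k) (pderiv (f i))) t) = sgn (poly ((pderiv ^^ k) (pderiv (g i))) t')" for k
    using st(2,3) it[of k] unfolding same_signs_def by metis+
  have F: "sgn (poly (pderiv (f i)) r) = sgn (poly (pderiv (f i)) s)" if "s \<le> r" "r \<le> t" for r
    using poly_sgn_between[OF dst that] .
  have G: "sgn (poly (pderiv (g i)) r) = sgn (poly (pderiv (f i)) s)" if "t' \<le> r" "r \<le> s'" for r
  proof -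
    have "sgn (poly (pderiv (g i)) r) = sgn (poly (pderiv (g i)) t')"
      by (rule poly_sgn_between[where t = s']) (use fg dst that in metis)+
    then show ?thesis using fg[of 0] dst[of 0] by simp
  qed
  have e: "sgn (poly (f i) s) = sgn (poly (g i) s')" "sgn (poly (f i) t) = sgn (poly (g i) t')"
    using st iI by (auto simp: same_signs_def)
  have ne: "sgn (poly (f i) s) \<noteq> sgn (poly (f i) t)" using i by (simp add: D_def)
  have up: "sgn (poly (f i) s) \<le> sgn (poly (f i) t) \<and> sgn (poly (g i) t') \<le> sgn (poly (g i) s')"
    if "poly (pderiv (f i)) s \<ge> 0"
  proof (intro conjI sgn_mono_real poly_mono_on_interval)
    show "poly (pderiv (f i)) r \<ge> 0" if "s \<le> r" "r \<le> t" for r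
      using F[OF that] \<open>poly (pderiv (f i)) s \<ge> 0\<close> by (auto simp: sgn_if split: if_splits)
    show "poly (pderiv (g i)) r \<ge> 0" if "t' \<le> r" "r \<le> s'" for r
      using G[OF that] \<open>poly (pderiv (f i)) s \<ge> 0\<close> by (auto simp: sgn_if split: if_splits)
  qed (use st ts in auto)
  have down: "sgn (poly (- f i) s) \<le> sgn (poly (- f i) t) \<and> sgn (poly (- g i) t') \<le> sgn (poly (- g i) s')"
    if "\<not> poly (pderiv (f i)) s \<ge> 0"
  proof (intro conjI sgn_mono_real poly_mono_on_interval)
    show "poly (pderiv (- f i)) r \<ge> 0" if "s \<le> r" "r \<le> t" for r
      using F[OF that] \<open>\<not> poly (pderiv (f i)) s \<ge> 0\<close> by (auto simp: sgn_if pderiv_minus split: if_splits)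
    show "poly (pderiv (- g i)) r \<ge> 0" if "t' \<le> r" "r \<le> s'" for r
      using G[OF that] \<open>\<not> poly (pderiv (f i)) s \<ge> 0\<close> by (auto simp: sgn_if pderiv_minus split: if_splits)
  qed (use st ts in auto)
  show False
  proof (cases "poly (pderiv (f i)) s \<ge> 0")
    case True
    then show False using up e ne by auto
  next
    case False
    then show False using down e ne by (auto simp: sgn_minus)
  qed
qed

text \<open>A root of a nonzero member is determined by its sign vector: by Thom's lemma, a second point with
  the same vector would make the member vanish on a whole interval.\<close>

lemma same_signs_root_unique:
  fixes f :: "'i \<Rightarrow> real poly"
  assumes f: "\<And>i. i \<in> I \<Longrightarrow> f (\<delta> i) = pderiv (f i)" and closed: "\<And>i. i \<in> I \<Longrightarrow> \<delta> i \<in> I"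
    and st: "same_signs I f f s t" and i: "i \<in> I" "f i \<noteq> 0" "poly (f i) s = 0"
  shows "s = t"
proof (rule ccontr)
  assume "s \<noteq> t"
  have it: "(\<delta> ^^ k) i \<in> I \<and> f ((\<delta> ^^ k) i) = (pderiv ^^ k) (f i)" for k
    by (induction k) (use f closed i in auto)
  have k: "sgn (poly ((pderiv ^^ k) (f i)) s) = sgn (poly ((pderiv ^^ k) (f i)) t)" for k
    using it[of k] st unfolding same_signs_def by metis
  have ti: "poly (f i) t = 0" using k[of 0] i(3) by (simp add: sgn_if split: if_splits)
  have sub: "{min s t..max s t} \<subseteq> {r. poly (f i) r = 0}"
  proof
    fix r assume r: "r \<in> {min s t..max s t}"
    have "sgn (poly (f i) r) = sgn (poly (f i) (min s t))"
      by (rule poly_sgn_between[where t = "max s t"]) (use k r in \<open>auto simp: min_def max_def\<close>)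
    moreover have "poly (f i) (min s t) = 0" using i(3) ti by (simp add: min_def)
    ultimately show "r \<in> {r. poly (f i) r = 0}" by (simp add: sgn_eq_0_iff)
  qed
  have "infinite {min s t..max s t}"
    using \<open>s \<noteq> t\<close> by (simp add: infinite_Icc_iff)
  then show False using sub poly_roots_finite[OF i(2)] finite_subset by blast
qed

text \<open>The setting in which a polynomial \<open>p\<close> (with its counterpart \<open>q\<close>) is adjoined to a family
  that contains its derivative: both families realise the same sign vectors in the same order,
  and the sign of \<open>p\<close> at the roots of the family is already controlled.\<close>

locale sign_step =
  fixes I :: "'i set" and f g :: "'i \<Rightarrow> real poly" and p q :: "real poly" and d :: 'i
  assumes fin: "finite I"
    and forth: "\<And>s. \<exists>t. same_signs I f g s t" and backw: "\<And>t. \<exists>s. same_signs I f g s t"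
    and order: "\<And>s t s' t'. \<lbrakk>same_signs I f g s s'; same_signs I f g t t'; \<not> same_signs I f g s t'\<rbrakk>
       \<Longrightarrow> s < t \<longleftrightarrow> s' < t'"
    and d: "d \<in> I" "f d = pderiv p" "g d = pderiv q"
    and roots: "\<And>i s t. \<lbrakk>i \<in> I; f i \<noteq> 0; poly (f i) s = 0; same_signs I f g s t\<rbrakk>
       \<Longrightarrow> sgn (poly p s) = sgn (poly q t)"
begin

lemma f_eq_0_iff: assumes "i \<in> I" shows "f i = 0 \<longleftrightarrow> g i = 0"
proof -
  have "(\<forall>s. poly (f i) s = 0) \<longleftrightarrow> (\<forall>s. poly (g i) s = 0)"
    using forth backw assms unfolding same_signs_def by (metis sgn_eq_0_iff)
  then show ?thesis by (simp add: poly_all_0_iff_0)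
qed

text \<open>The block of a point is the largest interval around it without roots of nonzero members of the
  family. If \<open>p\<close> increases at \<open>s\<close> and its sign there exceeds that of \<open>q\<close> at the partner \<open>t\<close>, then \<open>t\<close> has to
  move to the right within its block. At the right end of that block, which corresponds to the
  right end of the block of \<open>s\<close>, or far to the right if the block is unbounded, \<open>q\<close> is positive, so
  the intermediate value theorem applies.\<close>

lemma extend_right:
  assumes st: "same_signs I f g s t" and pos: "poly (pderiv p) s > 0"
    and gt: "sgn (poly q t) < sgn (poly p s)"
  shows "\<exists>t'. same_signs I f g s t' \<and> sgn (poly p s) = sgn (poly q t')"
proof -
  define Z where "Z h = {r. \<exists>i\<in>I. h i \<noteq> 0 \<and> poly (h i) r = 0}" for h :: "'i \<Rightarrow> real poly"
  have finZ: "finite (Z h)" for h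
  proof -
    have "Z h = (\<Union>i\<in>{i\<in>I. h i \<noteq> 0}. {r. poly (h i) r = 0})" by (auto simp: Z_def)
    then show ?thesis using fin poly_roots_finite by auto
  qed
  have Z_iff: "u \<in> Z f \<longleftrightarrow> r \<in> Z g" if "same_signs I f g u r" for u r
  proof -
    have "(f i \<noteq> 0 \<and> poly (f i) u = 0) \<longleftrightarrow> (g i \<noteq> 0 \<and> poly (g i) r = 0)" if "i \<in> I" for i
    proof -
      have "sgn (poly (f i) u) = sgn (poly (g i) r)"
        using \<open>same_signs I f g u r\<close> \<open>i \<in> I\<close> by (simp add: same_signs_def)
      then show ?thesis using sgn_eq_zero_iff f_eq_0_iff[OF \<open>i \<in> I\<close>] by blast
    qed
    then show ?thesis by (auto simp: Z_def)
  qed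
  have sZ: "s \<notin> Z f" using roots[OF _ _ _ st] gt by (auto simp: Z_def)
  have tZ: "t \<notin> Z g" using sZ Z_iff[OF st] by simp
  have const: "sgn (poly (h i) r) = sgn (poly (h i) u)"
    if "i \<in> I" "u \<le> r" "\<And>v. u \<le> v \<Longrightarrow> v \<le> r \<Longrightarrow> v \<notin> Z h" for h i u r
    using poly_sgn_no_root[of u r "h i" r] that by (cases "h i = 0") (auto simp: Z_def)
  have block: "same_signs I f g s r" if "t \<le> r" "\<And>v. t \<le> v \<Longrightarrow> v \<le> r \<Longrightarrow> v \<notin> Z g" for r
    using const[OF _ that] st unfolding same_signs_def by simp
  \<comment> \<open>The end of the block of \<open>t\<close>, or any large enough point if the block is unbounded.\<close>
  have "\<exists>v>t. (\<forall>r. t \<le> r \<and> r < v \<longrightarrow> same_signs I f g s r) \<and> poly q v > 0"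
  proof (cases "Z g \<inter> {t<..} = {}")
    case True
    then have noZ: "r \<notin> Z g" if "t \<le> r" for r
      using tZ that by (cases "t = r") auto
    have all: "same_signs I f g s r" if "t \<le> r" for r
      using block[OF that] noZ by blast
    have "poly (pderiv q) r > 0" if "t \<le> r" for r
    proof -
      have "sgn (poly (f d) s) = sgn (poly (g d) r)"
        using all[OF that] d(1) by (simp add: same_signs_def)
      then show ?thesis using pos d sgn_pos_iff by metis
    qed
    then show ?thesis using poly_eventually_pos_of_deriv_pos[of t q] all by auto
  next
    case False
    \<comment> \<open>\<open>v\<close> and \<open>w\<close> are the right ends of the blocks of \<open>t\<close> and \<open>s\<close>.\<close>
    define v where "v = Min (Z g \<inter> {t<..})"
    have v: "v \<in> Z g" "t < v" and vmin: "\<And>r. r \<in> Z g \<Longrightarrow> t < r \<Longrightarrow> v \<le> r"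
      using Min_in[OF _ False] finZ Min_le[of "Z g \<inter> {t<..}"] by (auto simp: v_def)
    obtain w0 where w0: "same_signs I f g w0 v" using backw by blast
    have w0Z: "w0 \<in> Z f" using v w0 Z_iff by blast
    have "\<not> same_signs I f g s v" using v(1) sZ Z_iff by blast
    then have "s < w0" using order[OF st w0] v by simp
    then have ne: "Z f \<inter> {s<..} \<noteq> {}" using w0Z by auto
    define w where "w = Min (Z f \<inter> {s<..})"
    have w: "w \<in> Z f" "s < w" and wmin: "\<And>r. r \<in> Z f \<Longrightarrow> s < r \<Longrightarrow> w \<le> r"
      using Min_in[OF _ ne] finZ Min_le[of "Z f \<inter> {s<..}"] by (auto simp: w_def)
    have "poly (pderiv p) r > 0" if "s < r" "r < w" for r
    proof -
      have "u \<notin> Z f" if "s \<le> u" "u \<le> r" for u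
        using sZ wmin[of u] that \<open>r < w\<close> by (cases "s = u") auto
      then have "sgn (poly (f d) r) = sgn (poly (f d) s)"
        using const[OF d(1)] \<open>s < r\<close> by (metis less_imp_le)
      then show ?thesis using pos d sgn_pos_iff by metis
    qed
    then have "poly p s < poly p w" using poly_strict_mono_on_interval w by blast
    moreover have "poly p s \<ge> 0" using gt by (auto simp: sgn_if split: if_splits)
    ultimately have pw: "poly p w > 0" by simp
    obtain v1 where v1: "same_signs I f g w v1" using forth by blast
    have v1Z: "v1 \<in> Z g" using w v1 Z_iff by blast
    have "\<not> same_signs I f g s v1" using v1Z sZ Z_iff by blast
    then have "t < v1" using order[OF st v1] w by simp
    then have vv1: "v \<le> v1" using vmin v1Z by blast
    have wv: "same_signs I f g w v"
    proof (rule ccontr)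
      assume n: "\<not> same_signs I f g w v"
      moreover have "w < w0"
        using n w0 wmin[OF w0Z \<open>s < w0\<close>] by (cases "w = w0") auto
      ultimately show False using order[OF v1 w0] vv1 by auto
    qed
    have "sgn (poly p w) = sgn (poly q v)"
      using roots[OF _ _ _ wv] w(1) unfolding Z_def by blast
    then have "poly q v > 0" using pw sgn_pos_iff by metis
    moreover have "same_signs I f g s r" if "t \<le> r" "r < v" for r
    proof (rule block[OF that(1)])
      show "u \<notin> Z g" if "t \<le> u" "u \<le> r" for u
        using tZ vmin[of u] that \<open>r < v\<close> by (cases "t = u") auto
    qed
    ultimately show ?thesis using v(2) by blast
  qed
  then obtain v where v: "v > t" "\<And>r. t \<le> r \<Longrightarrow> r < v \<Longrightarrow> same_signs I f g s r" "poly q v > 0"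
    by blast
  \<comment> \<open>A value with the sign of \<open>p\<close> at \<open>s\<close> that \<open>q\<close> attains between \<open>t\<close> and \<open>v\<close>.\<close>
  define c where "c = (if poly p s = 0 then 0 else poly q v / 2)"
  have c: "poly q t \<le> c" "c < poly q v" "sgn c = sgn (poly p s)"
    using gt v(3) by (auto simp: c_def sgn_if split: if_splits)
  obtain t' where t': "t \<le> t'" "t' \<le> v" "poly q t' = c"
    using IVT'[of "poly q" t c v] c v(1) by (force intro: continuous_intros)
  have "t' < v" using t' c by (cases "t' = v") auto
  then show ?thesis using v(2) t' c by metis
qed

lemma sign_step_uminus: "sign_step I (\<lambda>i. - f i) (\<lambda>i. - g i) (- p) (- q) d"
proof -
  have "same_signs I (\<lambda>i. - f i) (\<lambda>i. - g i) = same_signs I f g"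
    by (auto simp: same_signs_def fun_eq_iff sgn_minus)
  then show ?thesis
    by unfold_locales (use fin forth backw order d roots in \<open>auto simp: pderiv_minus sgn_minus\<close>)
qed

text \<open>Reflection in the origin; the additional sign change of \<open>p\<close> makes its derivative the
  reflection of the old one.\<close>

lemma sign_step_reflect:
  "sign_step I (\<lambda>i. f i \<circ>\<^sub>p [:0, -1:]) (\<lambda>i. g i \<circ>\<^sub>p [:0, -1:]) (- (p \<circ>\<^sub>p [:0, -1:])) (- (q \<circ>\<^sub>p [:0, -1:])) d"
proof -
  have eq: "same_signs I (\<lambda>i. f i \<circ>\<^sub>p [:0, -1:]) (\<lambda>i. g i \<circ>\<^sub>p [:0, -1:]) s t \<longleftrightarrow>
      same_signs I f g (- s) (- t)" for s t
    by (auto simp: same_signs_def poly_pcompose)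
  show ?thesis
  proof
    show "\<exists>t. same_signs I (\<lambda>i. f i \<circ>\<^sub>p [:0, -1:]) (\<lambda>i. g i \<circ>\<^sub>p [:0, -1:]) s t" for s
      using forth[of "- s"] unfolding eq by (metis minus_minus)
    show "\<exists>s. same_signs I (\<lambda>i. f i \<circ>\<^sub>p [:0, -1:]) (\<lambda>i. g i \<circ>\<^sub>p [:0, -1:]) s t" for t
      using backw[of "- t"] unfolding eq by (metis minus_minus)
    show "s < t \<longleftrightarrow> s' < t'"
      if "same_signs I (\<lambda>i. f i \<circ>\<^sub>p [:0, -1:]) (\<lambda>i. g i \<circ>\<^sub>p [:0, -1:]) s s'"
         "same_signs I (\<lambda>i. f i \<circ>\<^sub>p [:0, -1:]) (\<lambda>i. g i \<circ>\<^sub>p [:0, -1:]) t t'"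
         "\<not> same_signs I (\<lambda>i. f i \<circ>\<^sub>p [:0, -1:]) (\<lambda>i. g i \<circ>\<^sub>p [:0, -1:]) s t'" for s t s' t'
    proof -
      have "\<not> same_signs I f g (- t) (- s')"
      proof
        assume "same_signs I f g (- t) (- s')"
        then have "same_signs I f g (- s) (- t')"
          using that(1,2) unfolding eq by (simp add: same_signs_def)
        then show False using that(3) unfolding eq by simp
      qed
      then show ?thesis using order[of "- t" "- t'" "- s" "- s'"] that unfolding eq by simp
    qed
    show "sgn (poly (- (p \<circ>\<^sub>p [:0, -1:])) s) = sgn (poly (- (q \<circ>\<^sub>p [:0, -1:])) t)"
      if "i \<in> I" "f i \<circ>\<^sub>p [:0, -1:] \<noteq> 0" "poly (f i \<circ>\<^sub>p [:0, -1:]) s = 0"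
        "same_signs I (\<lambda>i. f i \<circ>\<^sub>p [:0, -1:]) (\<lambda>i. g i \<circ>\<^sub>p [:0, -1:]) s t" for i s t
      using that roots[of i "- s" "- t"] unfolding eq
      by (cases "f i = 0") (simp_all add: poly_pcompose sgn_minus)
  qed (use fin d in \<open>auto simp: pderiv_minus pderiv_pcompose pderiv_pCons\<close>)
qed

text \<open>In the case that is not covered by the previous lemma, the same argument moves \<open>t\<close> to the left.\<close>

lemma extend_deriv_pos:
  assumes st: "same_signs I f g s t" and pos: "poly (pderiv p) s > 0"
  shows "\<exists>t'. same_signs I f g s t' \<and> sgn (poly p s) = sgn (poly q t')"
proof (cases "sgn (poly p s)" "sgn (poly q t)" rule: linorder_cases)
  case less
  interpret R: sign_step I "\<lambda>i. f i \<circ>\<^sub>p [:0, -1:]" "\<lambda>i. g i \<circ>\<^sub>p [:0, -1:]"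
     "- (p \<circ>\<^sub>p [:0, -1:])" "- (q \<circ>\<^sub>p [:0, -1:])" d
    by (rule sign_step_reflect)
  have eq: "same_signs I (\<lambda>i. f i \<circ>\<^sub>p [:0, -1:]) (\<lambda>i. g i \<circ>\<^sub>p [:0, -1:]) s t \<longleftrightarrow>
      same_signs I f g (- s) (- t)" for s t
    by (auto simp: same_signs_def poly_pcompose)
  have "\<exists>t'. same_signs I f g s (- t') \<and> sgn (poly p s) = sgn (poly q (- t'))"
    using R.extend_right[of "- s" "- t"] st pos less unfolding eq
    by (auto simp: poly_pcompose sgn_minus pderiv_minus pderiv_pcompose pderiv_pCons)
  then show ?thesis by blast
qed (use st pos extend_right in auto)

lemma extend:
  assumes "pderiv p \<noteq> 0"
  shows "\<exists>t. same_signs I f g s t \<and> sgn (poly p s) = sgn (poly q t)"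
proof -
  obtain t where st: "same_signs I f g s t" using forth by blast
  consider "poly (pderiv p) s = 0" | "poly (pderiv p) s > 0" | "poly (pderiv p) s < 0" by linarith
  then show ?thesis
  proof cases
    case 1
    then show ?thesis using roots[OF d(1), of s t] st assms d(2) by auto
  next
    case 2
    then show ?thesis using extend_deriv_pos[OF st] by auto
  next
    case 3
    interpret N: sign_step I "\<lambda>i. - f i" "\<lambda>i. - g i" "- p" "- q" d by (rule sign_step_uminus)
    show ?thesis using N.extend_deriv_pos[of s t] st 3
      by (auto simp: same_signs_def sgn_minus pderiv_minus)
  qed
qed

end

section \<open>Elimination of one variable\<close>

text \<open>A family \<open>(c, n)\<close> of polynomials of formal degree \<open>n\<close> whose coefficients \<open>c 0, \<dots>, c n\<close> are
  functions of a parameter. Lowering \<open>n\<close> truncates the polynomials.\<close>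

type_synonym 'p fam = "(nat \<Rightarrow> 'p \<Rightarrow> real) \<times> nat"

definition fam_poly :: "'p fam \<Rightarrow> 'p \<Rightarrow> real poly" where
  "fam_poly e x = (\<Sum>i\<le>snd e. monom (fst e i x) i)"

text \<open>Differentiation with respect to the polynomial variable; a family of formal degree \<open>0\<close> has
  derivative zero.\<close>

definition fam_der :: "'p fam \<Rightarrow> 'p fam" where
  "fam_der e = (if snd e = 0 then (\<lambda>_ _. 0, 0)
     else (\<lambda>i x. real (Suc i) * fst e (Suc i) x, snd e - 1))"

text \<open>One step of the pseudo-division of \<open>e\<close> by \<open>e'\<close>; it cancels the formal leading term of \<open>e\<close>.\<close>

definition fam_red :: "'p fam \<Rightarrow> 'p fam \<Rightarrow> 'p fam" where
  "fam_red e e' = (\<lambda>i x. fst e' (snd e') x * fst e i x - fst e (snd e) x *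
     (if i + snd e' < snd e then 0 else fst e' (i + snd e' - snd e) x), snd e - 1)"

lemma coeff_fam_poly: "coeff (fam_poly e x) j = (if j \<le> snd e then fst e j x else 0)"
  by (auto simp: fam_poly_def coeff_sum coeff_monom)

lemma fam_poly_der: "fam_poly (fam_der e) x = pderiv (fam_poly e x)"
  by (rule poly_eqI) (auto simp: coeff_fam_poly fam_der_def coeff_pderiv)

lemma fam_poly_red:
  assumes "snd e' \<le> snd e" "snd e > 0"
  shows "fam_poly (fam_red e e') x = smult (fst e' (snd e') x) (fam_poly e x)
     - monom (fst e (snd e) x) (snd e - snd e') * fam_poly e' x"
proof (rule poly_eqI)
  fix n
  consider "n < snd e" | "n = snd e" | "n > snd e" by linarith
  then show "coeff (fam_poly (fam_red e e') x) n = coeff (smult (fst e' (snd e') x) (fam_poly e x)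
     - monom (fst e (snd e) x) (snd e - snd e') * fam_poly e' x) n"
    using assms by cases (auto simp: coeff_fam_poly fam_red_def coeff_monom_mult)
qed

text \<open>Closed under differentiation, truncation and passage to a coefficient.\<close>

definition fam_closed :: "'p fam set \<Rightarrow> bool" where
  "fam_closed F \<longleftrightarrow> (\<forall>e\<in>F. fam_der e \<in> F \<and>
     (\<forall>k\<le>snd e. (fst e, k) \<in> F \<and> (\<lambda>_. fst e k, 0) \<in> F))"

lemma fam_closed_UN: "(\<And>i. i \<in> I \<Longrightarrow> fam_closed (C i)) \<Longrightarrow> fam_closed (\<Union>i\<in>I. C i)"
  unfolding fam_closed_def by blast

lemma fam_closed_Un: "fam_closed C \<Longrightarrow> fam_closed D \<Longrightarrow> fam_closed (C \<union> D)"
  unfolding fam_closed_def by blast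

lemma fam_closed_insert:
  assumes "fam_closed C" "fam_der e \<in> insert e C"
    "\<And>k. k \<le> snd e \<Longrightarrow> (fst e, k) \<in> insert e C \<and> (\<lambda>_. fst e k, 0) \<in> insert e C"
  shows "fam_closed (insert e C)"
  using assms unfolding fam_closed_def by blast

text \<open>Rings of real functions that contain the constants.\<close>

locale function_ring =
  fixes K :: "('p \<Rightarrow> real) set"
  assumes const [intro]: "(\<lambda>_. c) \<in> K"
    and add [intro]: "a \<in> K \<Longrightarrow> b \<in> K \<Longrightarrow> (\<lambda>x. a x + b x) \<in> K"
    and mult [intro]: "a \<in> K \<Longrightarrow> b \<in> K \<Longrightarrow> (\<lambda>x. a x * b x) \<in> K"
begin

lemma diff [intro]: "a \<in> K \<Longrightarrow> b \<in> K \<Longrightarrow> (\<lambda>x. a x - b x) \<in> K"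
  using add[of a "\<lambda>x. (-1) * b x"] mult[OF const[of "-1"], of b] by simp

lemma sum [intro]: "(\<And>i. i \<in> I \<Longrightarrow> a i \<in> K) \<Longrightarrow> (\<lambda>x. \<Sum>i\<in>I. a i x) \<in> K"
  by (induction I rule: infinite_finite_induct) auto

text \<open>Families with coefficients in \<open>K\<close>.\<close>

definition fams :: "'p fam set" where "fams = {e. \<forall>i. fst e i \<in> K}"

lemma fam_red_in [intro]: "e \<in> fams \<Longrightarrow> e' \<in> fams \<Longrightarrow> fam_red e e' \<in> fams"
proof -
  assume e: "e \<in> fams" "e' \<in> fams"
  have "fst (fam_red e e') i \<in> K" for i
    using e unfolding fams_def fam_red_def
    by (cases "i + snd e' < snd e") (simp_all, (intro mult diff; simp)+)
  then show "fam_red e e' \<in> fams" by (simp add: fams_def)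
qed

text \<open>The closure adds to \<open>e\<close> only families of lower formal degree or of degree \<open>0\<close>.\<close>

lemma ex_closed_singleton:
  assumes "e \<in> fams"
  shows "\<exists>C. finite C \<and> fam_closed C \<and> e \<in> C \<and> C \<subseteq> fams \<and>
    (\<forall>e'\<in>C. e' = e \<or> snd e' < snd e \<or> snd e' = 0)"
  using assms
proof (induction "snd e" arbitrary: e)
  case 0
  show ?case
    by (rule exI[of _ "{e, (\<lambda>_. fst e 0, 0), (\<lambda>_ _. 0, 0)}"])
       (use 0 in \<open>cases e; auto simp: fam_closed_def fam_der_def fams_def\<close>)
next
  case (Suc n)
  define e1 where "e1 = (fst e, n)"
  have e1: "e1 \<in> fams" "n = snd e1" using Suc.prems by (auto simp: e1_def fams_def)
  have e2: "fam_der e \<in> fams" "n = snd (fam_der e)"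
    using Suc.prems Suc.hyps(2) by (auto simp: fam_der_def fams_def)
  obtain C1 where C1: "finite C1" "fam_closed C1" "e1 \<in> C1" "C1 \<subseteq> fams"
     "\<forall>e'\<in>C1. e' = e1 \<or> snd e' < snd e1 \<or> snd e' = 0"
    using Suc.hyps(1)[OF e1(2,1)] by blast
  obtain C2 where C2: "finite C2" "fam_closed C2" "fam_der e \<in> C2" "C2 \<subseteq> fams"
     "\<forall>e'\<in>C2. e' = fam_der e \<or> snd e' < snd (fam_der e) \<or> snd e' = 0"
    using Suc.hyps(1)[OF e2(2,1)] by blast
  define L :: "'p fam set" where "L = {(\<lambda>_. fst e (Suc n), 0), (\<lambda>_ _. 0, 0)}"
  have L: "fam_closed L" by (auto simp: L_def fam_closed_def fam_der_def)
  show ?case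
  proof (intro exI[of _ "insert e (L \<union> (C1 \<union> C2))"] conjI)
    have tr: "(fst e, k) \<in> C1 \<and> (\<lambda>_. fst e k, 0) \<in> C1" if "k \<le> n" for k
      using C1(2,3) that unfolding fam_closed_def e1_def by force
    have "(fst e, k) \<in> insert e (L \<union> (C1 \<union> C2)) \<and> (\<lambda>_. fst e k, 0) \<in> insert e (L \<union> (C1 \<union> C2))"
      if "k \<le> snd e" for k
    proof (cases "k = Suc n")
      case True
      then show ?thesis using Suc.hyps(2) by (cases e) (auto simp: L_def)
    next
      case False
      then show ?thesis using tr[of k] that Suc.hyps(2) by simp
    qed
    then show "fam_closed (insert e (L \<union> (C1 \<union> C2)))"
      using L C1(2) C2(2,3) by (intro fam_closed_insert fam_closed_Un) auto
    show "\<forall>e'\<in>insert e (L \<union> (C1 \<union> C2)). e' = e \<or> snd e' < snd e \<or> snd e' = 0"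
    proof
      fix e' assume "e' \<in> insert e (L \<union> (C1 \<union> C2))"
      then consider "e' = e" | "e' \<in> L" | "e' \<in> C1" | "e' \<in> C2" by blast
      then show "e' = e \<or> snd e' < snd e \<or> snd e' = 0"
      proof cases
        case 3
        then have "snd e' \<le> n" using C1(5) e1(2) by force
        then show ?thesis using Suc.hyps(2) by simp
      next
        case 4
        then have "snd e' \<le> n" using C2(5) e2(2) by force
        then show ?thesis using Suc.hyps(2) by simp
      qed (auto simp: L_def)
    qed
    have "L \<subseteq> fams" using Suc.prems by (auto simp: L_def fams_def)
    then show "insert e (L \<union> (C1 \<union> C2)) \<subseteq> fams" using Suc.prems C1(4) C2(4) by blast
    show "finite (insert e (L \<union> (C1 \<union> C2)))" using C1(1) C2(1) by (simp add: L_def)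
  qed simp
qed

lemma ex_closed:
  assumes "finite F" "F \<subseteq> fams"
  shows "\<exists>C. finite C \<and> fam_closed C \<and> F \<subseteq> C \<and> C \<subseteq> fams \<and>
    (\<forall>e'\<in>C. e' \<in> F \<or> snd e' = 0 \<or> (\<exists>e\<in>F. snd e' < snd e))"
proof -
  have "\<forall>e\<in>F. \<exists>C. finite C \<and> fam_closed C \<and> e \<in> C \<and> C \<subseteq> fams \<and>
    (\<forall>e'\<in>C. e' = e \<or> snd e' < snd e \<or> snd e' = 0)"
    using ex_closed_singleton assms by blast
  then obtain C where C: "\<And>e. e \<in> F \<Longrightarrow> finite (C e) \<and> fam_closed (C e) \<and> e \<in> C e \<and> C e \<subseteq> fams \<and>
    (\<forall>e'\<in>C e. e' = e \<or> snd e' < snd e \<or> snd e' = 0)"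
    by metis
  show ?thesis
  proof (intro exI[of _ "\<Union>e\<in>F. C e"] conjI)
    show "fam_closed (\<Union>e\<in>F. C e)" using C by (intro fam_closed_UN) blast
    show "F \<subseteq> (\<Union>e\<in>F. C e)" using C by blast
    show "(\<Union>e\<in>F. C e) \<subseteq> fams" using C by blast
    show "finite (\<Union>e\<in>F. C e)" using C assms(1) by simp
    show "\<forall>e'\<in>\<Union>e\<in>F. C e. e' \<in> F \<or> snd e' = 0 \<or> (\<exists>e\<in>F. snd e' < snd e)"
    proof
      fix e' assume "e' \<in> (\<Union>e\<in>F. C e)"
      then obtain e where e: "e \<in> F" "e' \<in> C e" by blast
      from C[OF e(1)] have "\<forall>e'\<in>C e. e' = e \<or> snd e' < snd e \<or> snd e' = 0"
        by (elim conjE)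
      then have "e' = e \<or> snd e' < snd e \<or> snd e' = 0" using e(2) by (rule bspec)
      then show "e' \<in> F \<or> snd e' = 0 \<or> (\<exists>e\<in>F. snd e' < snd e)" using e(1) by metis
    qed
  qed
qed

text \<open>The set of sign vectors realised by the members of \<open>F\<close> depends only on the signs, at the
  parameter, of finitely many functions in \<open>K\<close>.\<close>

definition sign_determined :: "'p fam set \<Rightarrow> bool" where
  "sign_determined F \<longleftrightarrow> (\<exists>A. finite A \<and> A \<subseteq> K \<and>
     (\<forall>x y. (\<forall>a\<in>A. sgn (a x) = sgn (a y)) \<longrightarrow>
       (\<forall>s. \<exists>t. same_signs F (\<lambda>e. fam_poly e x) (\<lambda>e. fam_poly e y) s t)))"

lemma sign_determined_subset:
  assumes "sign_determined G" "F \<subseteq> G"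
  shows "sign_determined F"
proof -
  obtain A where A: "finite A" "A \<subseteq> K" and G: "\<forall>x y. (\<forall>a\<in>A. sgn (a x) = sgn (a y)) \<longrightarrow>
     (\<forall>s. \<exists>t. same_signs G (\<lambda>e. fam_poly e x) (\<lambda>e. fam_poly e y) s t)"
    using assms(1) unfolding sign_determined_def by (elim exE conjE)
  show ?thesis unfolding sign_determined_def
  proof (intro exI[of _ A] conjI allI impI A)
    fix x y and s :: real
    assume "\<forall>a\<in>A. sgn (a x) = sgn (a y)"
    then obtain t where "same_signs G (\<lambda>e. fam_poly e x) (\<lambda>e. fam_poly e y) s t" using G by metis
    then show "\<exists>t. same_signs F (\<lambda>e. fam_poly e x) (\<lambda>e. fam_poly e y) s t"
      using same_signs_subset assms(2) by blast
  qed
qed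

text \<open>A member \<open>p\<close> of largest formal degree can be traded for its remainders. At a root of another
  member \<open>e\<close>, the sign of \<open>p\<close> follows from that of the remainder of \<open>p\<close> by \<open>e\<close>, once \<open>e\<close> is truncated to its
  actual degree at the given parameter; elsewhere \<open>p\<close> is controlled by its derivative.\<close>

lemma sign_determined_step:
  assumes F: "finite F" "fam_closed F" and p: "p \<in> F" "snd p > 0" "\<And>e. e \<in> F \<Longrightarrow> snd e \<le> snd p"
    and G: "F - {p} \<subseteq> G" "fam_red p ` (F - {p}) \<subseteq> G" "sign_determined G"
  shows "sign_determined F"
proof -
  define I where "I = F - {p}"
  have IF: "e \<in> I" if "e \<in> F" "snd e < snd p" for e using that by (auto simp: I_def)
  have der: "fam_der e \<in> I" if "e \<in> F" for e
  proof (rule IF)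
    show "fam_der e \<in> F" using F that by (auto simp: fam_closed_def)
    show "snd (fam_der e) < snd p" using p(2) p(3)[OF that] by (auto simp: fam_der_def)
  qed
  have derI: "fam_der e \<in> I" if "e \<in> I" for e using der that by (auto simp: I_def)
  have lc: "(\<lambda>_. fst e k, 0) \<in> I" if "e \<in> F" "k \<le> snd e" for e k
    using F that p(2) by (intro IF) (auto simp: fam_closed_def)
  have tr: "(fst p, snd p - 1) \<in> I"
    using F(2) p(1,2) by (intro IF) (auto simp: fam_closed_def)
  obtain A where A12: "finite A" "A \<subseteq> K" and A3: "\<forall>x y. (\<forall>a\<in>A. sgn (a x) = sgn (a y)) \<longrightarrow>
     (\<forall>s. \<exists>t. same_signs G (\<lambda>e. fam_poly e x) (\<lambda>e. fam_poly e y) s t)"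
    using G(3) unfolding sign_determined_def by (elim exE conjE)
  have "\<exists>t. same_signs F (\<lambda>e. fam_poly e x) (\<lambda>e. fam_poly e y) s t"
    if xy: "\<And>a. a \<in> A \<Longrightarrow> sgn (a x) = sgn (a y)" for x y s
  proof -
    let ?f = "\<lambda>e. fam_poly e x" and ?g = "\<lambda>e. fam_poly e y"
    have GI: "same_signs G f g s t \<Longrightarrow> same_signs I f g s t" for f g s t
      using G(1) unfolding same_signs_def I_def by blast
    have forthG: "\<exists>t. same_signs G ?f ?g s t" for s using A3 xy by simp
    have backG: "\<exists>s. same_signs G ?f ?g s t" for t
    proof -
      obtain s where "same_signs G ?g ?f t s" using A3 xy by metis
      then show ?thesis using same_signs_sym by blast
    qed
    have coeffs: "sgn (fst e k x) = sgn (fst e k y)" if "e \<in> F" "k \<le> snd e" for e k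
    proof -
      obtain t where "same_signs I ?f ?g 0 t" using forthG GI by blast
      then have "sgn (poly (?f (\<lambda>_. fst e k, 0)) 0) = sgn (poly (?g (\<lambda>_. fst e k, 0)) t)"
        using lc[OF that] unfolding same_signs_def by blast
      then show ?thesis by (simp add: fam_poly_def poly_monom)
    qed
    have FI: "same_signs F ?f ?g s t \<longleftrightarrow> same_signs I ?f ?g s t \<and> sgn (poly (?f p) s) = sgn (poly (?g p) t)" for s t
      using p(1) unfolding same_signs_def I_def by blast
    show ?thesis
    proof (cases "fst p (snd p) x = 0")
      case True
      then have y0: "fst p (snd p) y = 0" using coeffs[OF p(1), of "snd p"] by (simp add: sgn_0_0)
      have "fam_poly p z = fam_poly (fst p, snd p - 1) z" if "fst p (snd p) z = 0" for z
        using that by (intro poly_eqI) (auto simp: coeff_fam_poly le_less)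
      then have "?f p = ?f (fst p, snd p - 1)" "?g p = ?g (fst p, snd p - 1)" using True y0 by auto
      moreover obtain t where t: "same_signs I ?f ?g s t" using forthG GI by blast
      then have "sgn (poly (?f (fst p, snd p - 1)) s) = sgn (poly (?g (fst p, snd p - 1)) t)"
        using tr unfolding same_signs_def by blast
      ultimately have "same_signs F ?f ?g s t" using t unfolding FI by simp
      then show ?thesis ..
    next
      case False
      interpret sign_step I ?f ?g "?f p" "?g p" "fam_der p"
      proof
        show "finite I" using F by (simp add: I_def)
        show "\<exists>t. same_signs I ?f ?g s t" for s using forthG GI by blast
        show "\<exists>s. same_signs I ?f ?g s t" for t using backG GI by blast
        show "fam_der p \<in> I" using der p by blast
        show "?f (fam_der p) = pderiv (?f p)" "?g (fam_der p) = pderiv (?g p)"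
          by (simp_all add: fam_poly_der)
        show "s < t \<longleftrightarrow> s' < t'"
          if "same_signs I ?f ?g s s'" "same_signs I ?f ?g t t'" "\<not> same_signs I ?f ?g s t'" for s t s' t'
        proof
          assume "s < t"
          show "s' < t'"
            by (rule same_signs_less[where \<delta> = fam_der, OF _ _ _ \<open>s < t\<close> that])
               (auto simp: fam_poly_der derI)
        next
          assume "s' < t'"
          have "\<not> same_signs I ?f ?g t s'"
          proof
            assume "same_signs I ?f ?g t s'"
            then have "same_signs I ?f ?g s t'" using that(1,2) by (simp add: same_signs_def)
            then show False using that(3) by contradiction
          qed
          with that have "same_signs I ?g ?f s' s" "same_signs I ?g ?f t' t" "\<not> same_signs I ?g ?f s' t"
            by (simp_all add: same_signs_sym)
          then show "s < t"
            by (intro same_signs_less[where \<delta> = fam_der, OF _ _ _ \<open>s' < t'\<close>])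
               (auto simp: fam_poly_der derI)
        qed
        show "sgn (poly (?f p) s) = sgn (poly (?g p) t)"
          if e: "e \<in> I" "?f e \<noteq> 0" "poly (?f e) s = 0" and st: "same_signs I ?f ?g s t" for e s t
        proof -
          have eF: "e \<in> F" using e by (simp add: I_def)
          obtain t0 where t0: "same_signs G ?f ?g s t0" using forthG by blast
          have "sgn (poly (?f e) s) = sgn (poly (?g e) t0)" using GI[OF t0] e(1) by (simp add: same_signs_def)
          then have "poly (?g e) t0 = 0" using e(3) by (simp add: sgn_0_0)
          \<comment> \<open>The formal degree of the truncation of \<open>e\<close> that has the same value at \<open>x\<close>.\<close>
          define k where "k = degree (?f e)"
          have k: "k \<le> snd e" "fst e k x \<noteq> 0"
            using e(2) coeff_fam_poly[of e x k] by (auto simp: k_def split: if_splits)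
          have above: "fst e j z = 0" if "k < j" "j \<le> snd e" "z \<in> {x, y}" for j z
          proof -
            have "fst e j x = 0"
              using coeff_eq_0[of "?f e" j] that coeff_fam_poly[of e x j] by (simp add: k_def)
            then show ?thesis using coeffs[OF eF that(2)] that(3) by (auto simp: sgn_0_0)
          qed
          define e' where "e' = (fst e, k)"
          have "e' \<in> F" using F(2) eF k unfolding fam_closed_def e'_def by blast
          have ee': "fam_poly e z = fam_poly e' z" if "z \<in> {x, y}" for z
            using above[OF _ _ that] k by (intro poly_eqI) (auto simp: coeff_fam_poly e'_def not_le)
          have "?f e = ?f e'" "?g e = ?g e'" using ee' by auto
          have gnz: "?g e \<noteq> 0"
            using coeff_fam_poly[of e y k] k coeffs[OF eF k(1)] by (auto simp: sgn_0_0)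
          \<comment> \<open>The partner of \<open>s\<close> for the larger family \<open>G\<close>, which contains the remainder, is \<open>t\<close> itself.\<close>
          have "t0 = t"
          proof (rule same_signs_root_unique[where I = I and f = ?g and \<delta> = fam_der and i = e])
            show "same_signs I ?g ?g t0 t" using GI[OF t0] st by (simp add: same_signs_def)
          qed (use e gnz \<open>poly (?g e) t0 = 0\<close> derI in \<open>auto simp: fam_poly_der\<close>)
          show ?thesis
          proof (cases "e' = p")
            case True
            then show ?thesis
              using \<open>?f e = ?f e'\<close> \<open>?g e = ?g e'\<close> e(3) \<open>poly (?g e) t0 = 0\<close> \<open>t0 = t\<close> by simp
          next
            case False
            then have "fam_red p e' \<in> G" using G(2) \<open>e' \<in> F\<close> by blast
            then have "sgn (poly (?f (fam_red p e')) s) = sgn (poly (?g (fam_red p e')) t)"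
              using t0 \<open>t0 = t\<close> by (simp add: same_signs_def)
            moreover have "fam_poly (fam_red p e') z = smult (fst e k z) (fam_poly p z)
                - monom (fst p (snd p) z) (snd p - k) * fam_poly e' z" for z
              using fam_poly_red[of e' p z] p(2) p(3)[OF \<open>e' \<in> F\<close>] by (simp add: e'_def)
            ultimately have "sgn (fst e k x) * sgn (poly (?f p) s) = sgn (fst e k y) * sgn (poly (?g p) t)"
              using \<open>?f e = ?f e'\<close> \<open>?g e = ?g e'\<close> e(3) \<open>poly (?g e) t0 = 0\<close> \<open>t0 = t\<close>
              by (simp add: sgn_mult)
            moreover have "sgn (fst e k x) = sgn (fst e k y)" "sgn (fst e k x) \<noteq> 0"
              using coeffs[OF eF k(1)] k by (auto simp: sgn_0_0)
            ultimately show ?thesis by simp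
          qed
        qed
      qed
      have "coeff (?f p) (snd p) \<noteq> 0" using False by (simp add: coeff_fam_poly)
      then have "degree (?f p) \<noteq> 0" using p(2) le_degree by fastforce
      then have "pderiv (?f p) \<noteq> 0" by (simp add: pderiv_eq_0_iff)
      then show ?thesis using extend unfolding FI by blast
    qed
  qed
  then show ?thesis unfolding sign_determined_def using A12
    by (intro exI[of _ A] conjI allI impI) simp_all
qed

text \<open>Induction on the largest formal degree and on the number of members that attain it.\<close>

lemma sign_determined_closed:
  assumes "finite F" "F \<subseteq> fams" "fam_closed F" "\<And>e. e \<in> F \<Longrightarrow> snd e \<le> n"
  shows "sign_determined F"
  using assms
proof (induction n arbitrary: F)
  case 0
  show ?case unfolding sign_determined_def
  proof (intro exI[of _ "(\<lambda>e. fst e 0) ` F"] conjI allI impI)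
    show "(\<lambda>e. fst e 0) ` F \<subseteq> K" using 0(2) by (auto simp: fams_def)
    fix x y and s :: real
    assume A: "\<forall>a\<in>(\<lambda>e. fst e 0) ` F. sgn (a x) = sgn (a y)"
    have "poly (fam_poly e z) u = fst e 0 z" if "e \<in> F" for e z u
      using 0(4)[OF that] by (simp add: fam_poly_def poly_monom)
    then have "same_signs F (\<lambda>e. fam_poly e x) (\<lambda>e. fam_poly e y) s s"
      using A by (simp add: same_signs_def)
    then show "\<exists>t. same_signs F (\<lambda>e. fam_poly e x) (\<lambda>e. fam_poly e y) s t" ..
  qed (use 0(1) in simp)
next
  case (Suc n)
  define top where "top F = {e \<in> F. snd e = Suc n}" for F :: "'p fam set"
  show ?case using Suc.prems
  proof (induction "card (top F)" arbitrary: F rule: less_induct)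
    case less
    show ?case
    proof (cases "top F = {}")
      case True
      have "snd e \<le> n" if "e \<in> F" for e
      proof -
        have "snd e \<noteq> Suc n" using True that unfolding top_def by blast
        then show ?thesis using less.prems(4)[OF that] by simp
      qed
      then show ?thesis using Suc.IH[OF less.prems(1-3)] by blast
    next
      case False
      then obtain p where p: "p \<in> F" "snd p = Suc n" by (auto simp: top_def)
      define S where "S = (F - {p}) \<union> fam_red p ` (F - {p})"
      have red: "snd (fam_red p e) = n" for e using p by (simp add: fam_red_def)
      have "fam_red p e \<in> fams" if "e \<in> F" for e
        using less.prems(2) p(1) that by (intro fam_red_in) auto
      then have S: "finite S" "S \<subseteq> fams" using less.prems(1,2) by (auto simp: S_def)
      obtain G where G: "finite G" "fam_closed G" "S \<subseteq> G" "G \<subseteq> fams"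
        "\<forall>e'\<in>G. e' \<in> S \<or> snd e' = 0 \<or> (\<exists>e\<in>S. snd e' < snd e)"
        using ex_closed[OF S] by blast
      have Sn: "snd e \<le> Suc n" if "e \<in> S" for e
      proof -
        have "e \<in> F \<or> snd e = n" using that red unfolding S_def by blast
        then show ?thesis using less.prems(4)[of e] by (elim disjE) simp_all
      qed
      have Gn: "snd e \<le> Suc n" if "e \<in> G" for e
      proof -
        have "e \<in> S \<or> snd e = 0 \<or> (\<exists>e0\<in>S. snd e < snd e0)" using G(5) that by (rule bspec)
        then show ?thesis using Sn by (metis le0 less_imp_le_nat less_le_trans)
      qed
      have "top G \<subseteq> top F - {p}"
      proof
        fix e assume "e \<in> top G"
        then have e: "e \<in> G" "snd e = Suc n" by (auto simp: top_def)
        have "e \<in> S \<or> snd e = 0 \<or> (\<exists>e0\<in>S. snd e < snd e0)" using G(5) e(1) by (rule bspec)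
        then have "e \<in> S" using Sn e(2) by (metis leD nat.distinct(1))
        moreover have "e \<notin> fam_red p ` (F - {p})" using red e(2) by (metis imageE n_not_Suc_n)
        ultimately show "e \<in> top F - {p}" using e(2) by (simp add: S_def top_def)
      qed
      moreover have "finite (top F)" using less.prems(1) by (simp add: top_def)
      moreover have "p \<in> top F" using p by (simp add: top_def)
      ultimately have "card (top G) < card (top F)"
        by (intro psubset_card_mono) auto
      then have "sign_determined G" using less.hyps[OF _ G(1,4,2)] Gn by simp
      then show ?thesis
        using sign_determined_step[OF less.prems(1,3) p(1) _ _ _ _ \<open>sign_determined G\<close>]
          p(2) less.prems(4) G(3) by (simp add: S_def)
    qed
  qed
qed

theorem sign_determined_finite: "finite F \<Longrightarrow> F \<subseteq> fams \<Longrightarrow> sign_determined F"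
proof -
  assume "finite F" "F \<subseteq> fams"
  then obtain C where C: "finite C" "fam_closed C" "F \<subseteq> C" "C \<subseteq> fams"
    using ex_closed[of F] by blast
  have "sign_determined C"
    by (rule sign_determined_closed[where n = "Max (snd ` C)"]) (use C in auto)
  then show ?thesis using sign_determined_subset C(3) by blast
qed

end

section \<open>Projections of semialgebraic sets to the line\<close>

text \<open>Polynomial functions of the first \<open>n\<close> coordinates of a sequence.\<close>

inductive_set polyfun :: "nat \<Rightarrow> ((nat \<Rightarrow> real) \<Rightarrow> real) set" for n where
  const: "(\<lambda>_. c) \<in> polyfun n"
| coord: "i < n \<Longrightarrow> (\<lambda>v. v i) \<in> polyfun n"
| add: "a \<in> polyfun n \<Longrightarrow> b \<in> polyfun n \<Longrightarrow> (\<lambda>v. a v + b v) \<in> polyfun n"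
| mult: "a \<in> polyfun n \<Longrightarrow> b \<in> polyfun n \<Longrightarrow> (\<lambda>v. a v * b v) \<in> polyfun n"

interpretation pf: function_ring "polyfun n" for n
  by unfold_locales (auto intro: polyfun.intros)

lemma polyfun_Suc_poly:
  assumes "f \<in> polyfun (Suc n)"
  shows "\<exists>P d. (\<forall>v. degree (P v) \<le> d) \<and> (\<forall>i. (\<lambda>v. coeff (P v) i) \<in> polyfun n) \<and>
    (\<forall>v t. f (v(n := t)) = poly (P v) t)"
  using assms
proof induction
  case (const c)
  show ?case
  proof (intro exI conjI allI)
    show "degree ((\<lambda>_. [:c:]) v) \<le> 0" for v :: "nat \<Rightarrow> real" by simp
    show "(\<lambda>v. coeff ((\<lambda>_. [:c:]) v) i) \<in> polyfun n" for i by (rule polyfun.const)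
  qed simp
next
  case (coord i)
  show ?case
  proof (cases "i = n")
    case True
    show ?thesis
    proof (intro exI conjI allI)
      show "degree ((\<lambda>_. [:0, 1:]) v) \<le> 1" for v :: "nat \<Rightarrow> real" by simp
      show "(\<lambda>v. coeff ((\<lambda>_. [:0, 1:]) v) i) \<in> polyfun n" for i by (rule polyfun.const)
    qed (simp add: True)
  next
    case False
    show ?thesis
    proof (intro exI conjI allI)
      show "degree ((\<lambda>v. [:v i:]) v) \<le> 0" for v :: "nat \<Rightarrow> real" by simp
      show "(\<lambda>v. coeff ((\<lambda>v. [:v i:]) v) j) \<in> polyfun n" for j
        using False coord by (cases j) (auto intro: polyfun.intros)
    qed (simp add: False)
  qed
next
  case (add a b)
  then obtain P d Q e where P: "\<And>v. degree (P v) \<le> d" "\<And>i. (\<lambda>v. coeff (P v) i) \<in> polyfun n"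
    "\<And>v t. a (v(n := t)) = poly (P v) t"
    and Q: "\<And>v. degree (Q v) \<le> e" "\<And>i. (\<lambda>v. coeff (Q v) i) \<in> polyfun n"
    "\<And>v t. b (v(n := t)) = poly (Q v) t" by metis
  show ?case
  proof (intro exI conjI allI)
    show "degree ((\<lambda>v. P v + Q v) v) \<le> max d e" for v :: "nat \<Rightarrow> real"
      using P(1) Q(1) by (meson degree_add_le_max le_trans max.mono)
    show "(\<lambda>v. coeff ((\<lambda>v. P v + Q v) v) i) \<in> polyfun n" for i
      using polyfun.add[OF P(2) Q(2)] by simp
  qed (simp only: P(3) Q(3) poly_add)
next
  case (mult a b)
  then obtain P d Q e where P: "\<And>v. degree (P v) \<le> d" "\<And>i. (\<lambda>v. coeff (P v) i) \<in> polyfun n"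
    "\<And>v t. a (v(n := t)) = poly (P v) t"
    and Q: "\<And>v. degree (Q v) \<le> e" "\<And>i. (\<lambda>v. coeff (Q v) i) \<in> polyfun n"
    "\<And>v t. b (v(n := t)) = poly (Q v) t" by metis
  show ?case
  proof (intro exI conjI allI)
    show "degree ((\<lambda>v. P v * Q v) v) \<le> d + e" for v :: "nat \<Rightarrow> real"
      using P(1) Q(1) by (meson degree_mult_le le_trans add_mono)
    show "(\<lambda>v. coeff ((\<lambda>v. P v * Q v) v) i) \<in> polyfun n" for i
      unfolding coeff_mult by (intro pf.sum polyfun.mult P Q)
  qed (simp only: P(3) Q(3) poly_mult)
qed

lemma polyfun_Suc_fam:
  assumes "f \<in> polyfun (Suc n)"
  shows "\<exists>e \<in> pf.fams n. \<forall>v t. f (v(n := t)) = poly (fam_poly e v) t"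
proof -
  obtain P d where P: "\<And>v. degree (P v) \<le> d" "\<And>i. (\<lambda>v. coeff (P v) i) \<in> polyfun n"
    "\<And>v t. f (v(n := t)) = poly (P v) t"
    using polyfun_Suc_poly[OF assms] by metis
  define e where "e = (\<lambda>i v. coeff (P v) i, d)"
  have "fam_poly e v = P v" for v
    using P(1)[of v] by (intro poly_eqI) (auto simp: coeff_fam_poly e_def coeff_eq_0)
  moreover have "e \<in> pf.fams n" using P(2) by (simp add: e_def pf.fams_def)
  ultimately show ?thesis using P(3) by metis
qed

text \<open>Membership in the set depends only on the signs of finitely many polynomial functions of
  the first \<open>n\<close> coordinates.\<close>

definition determined :: "nat \<Rightarrow> (nat \<Rightarrow> real) set \<Rightarrow> bool" where
  "determined n S \<longleftrightarrow> (\<exists>A. finite A \<and> A \<subseteq> polyfun n \<and>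
     (\<forall>v w. (\<forall>a\<in>A. sgn (a v) = sgn (a w)) \<longrightarrow> v \<in> S \<longrightarrow> w \<in> S))"

lemma determined_Compl:
  assumes "determined n S"
  shows "determined n (- S)"
proof -
  obtain F where F: "finite F" "F \<subseteq> polyfun n"
    and S: "\<forall>v w. (\<forall>a\<in>F. sgn (a v) = sgn (a w)) \<longrightarrow> v \<in> S \<longrightarrow> w \<in> S"
    using assms(1) unfolding determined_def by (elim exE conjE)
  show ?thesis unfolding determined_def
  proof (intro exI[of _ F] conjI allI impI F)
    fix v w assume vw: "\<forall>a\<in>F. sgn (a v) = sgn (a w)" and v: "v \<in> - S"
    have "w \<in> S \<Longrightarrow> v \<in> S" using S[rule_format, of w v] vw by simp
    then show "w \<in> - S" using v by auto
  qed
qed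

lemma determined_Un:
  assumes "determined n S" "determined n T"
  shows "determined n (S \<union> T)"
proof -
  obtain F where F: "finite F" "F \<subseteq> polyfun n"
    and S: "\<forall>v w. (\<forall>a\<in>F. sgn (a v) = sgn (a w)) \<longrightarrow> v \<in> S \<longrightarrow> w \<in> S"
    using assms(1) unfolding determined_def by (elim exE conjE)
  obtain G where G: "finite G" "G \<subseteq> polyfun n"
    and T: "\<forall>v w. (\<forall>a\<in>G. sgn (a v) = sgn (a w)) \<longrightarrow> v \<in> T \<longrightarrow> w \<in> T"
    using assms(2) unfolding determined_def by (elim exE conjE)
  show ?thesis unfolding determined_def
  proof (intro exI[of _ "F \<union> G"] conjI allI impI)
    fix v w assume vw: "\<forall>a\<in>F \<union> G. sgn (a v) = sgn (a w)" and v: "v \<in> S \<union> T"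
    have "v \<in> S \<Longrightarrow> w \<in> S" using S[rule_format, of v w] vw by simp
    moreover have "v \<in> T \<Longrightarrow> w \<in> T" using T[rule_format, of v w] vw by simp
    ultimately show "w \<in> S \<union> T" using v by auto
  qed (use F G in simp_all)
qed

lemma determined_Int:
  assumes "determined n S" "determined n T"
  shows "determined n (S \<inter> T)"
proof -
  obtain F where F: "finite F" "F \<subseteq> polyfun n"
    and S: "\<forall>v w. (\<forall>a\<in>F. sgn (a v) = sgn (a w)) \<longrightarrow> v \<in> S \<longrightarrow> w \<in> S"
    using assms(1) unfolding determined_def by (elim exE conjE)
  obtain G where G: "finite G" "G \<subseteq> polyfun n"
    and T: "\<forall>v w. (\<forall>a\<in>G. sgn (a v) = sgn (a w)) \<longrightarrow> v \<in> T \<longrightarrow> w \<in> T"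
    using assms(2) unfolding determined_def by (elim exE conjE)
  show ?thesis unfolding determined_def
  proof (intro exI[of _ "F \<union> G"] conjI allI impI)
    fix v w assume vw: "\<forall>a\<in>F \<union> G. sgn (a v) = sgn (a w)" and v: "v \<in> S \<inter> T"
    have "v \<in> S \<Longrightarrow> w \<in> S" using S[rule_format, of v w] vw by simp
    moreover have "v \<in> T \<Longrightarrow> w \<in> T" using T[rule_format, of v w] vw by simp
    ultimately show "w \<in> S \<inter> T" using v by auto
  qed (use F G in simp_all)
qed

text \<open>Quantifier elimination for one real variable.\<close>

lemma determined_project:
  assumes "determined (Suc n) S"
  shows "determined n {v. \<exists>t. v(n := t) \<in> S}"
proof -
  obtain A where A: "finite A" "A \<subseteq> polyfun (Suc n)"
    and S: "\<forall>v w. (\<forall>a\<in>A. sgn (a v) = sgn (a w)) \<longrightarrow> v \<in> S \<longrightarrow> w \<in> S"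
    using assms unfolding determined_def by (elim exE conjE)
  have "\<forall>a\<in>A. \<exists>e. e \<in> pf.fams n \<and> (\<forall>v t. a (v(n := t)) = poly (fam_poly e v) t)"
    using A(2) polyfun_Suc_fam by blast
  then obtain e where e: "\<And>a. a \<in> A \<Longrightarrow> e a \<in> pf.fams n"
    "\<And>a v t. a \<in> A \<Longrightarrow> a (v(n := t)) = poly (fam_poly (e a) v) t" by metis
  have "pf.sign_determined n (e ` A)"
    by (rule pf.sign_determined_finite) (use A(1) e(1) in blast)+
  then obtain B where B: "finite B" "B \<subseteq> polyfun n" and
    T: "\<forall>x y. (\<forall>a\<in>B. sgn (a x) = sgn (a y)) \<longrightarrow>
       (\<forall>s. \<exists>t. same_signs (e ` A) (\<lambda>e. fam_poly e x) (\<lambda>e. fam_poly e y) s t)"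
    unfolding pf.sign_determined_def by (elim exE conjE)
  show ?thesis unfolding determined_def
  proof (intro exI[of _ B] conjI allI impI B)
    fix v w assume vw: "\<forall>a\<in>B. sgn (a v) = sgn (a w)" and "v \<in> {v. \<exists>t. v(n := t) \<in> S}"
    then obtain s where s: "v(n := s) \<in> S" by blast
    obtain t where "same_signs (e ` A) (\<lambda>e. fam_poly e v) (\<lambda>e. fam_poly e w) s t"
      using T vw by metis
    then have "sgn (a (v(n := s))) = sgn (a (w(n := t)))" if "a \<in> A" for a
      using e(2)[OF that] that by (simp add: same_signs_def)
    then have "w(n := t) \<in> S" using S s by metis
    then show "w \<in> {v. \<exists>t. v(n := t) \<in> S}" by blast
  qed
qed

lemma determined_project_many:
  "determined (k + N) S \<Longrightarrow>
    determined k {v. \<exists>z. (\<lambda>i. if k \<le> i \<and> i < k + N then z i else v i) \<in> S}"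
proof (induction N arbitrary: S)
  case 0
  have "(\<lambda>i. if k \<le> i \<and> i < k + 0 then z i else v i) = v" for z v :: "nat \<Rightarrow> real" by auto
  then show ?case using 0 by simp
next
  case (Suc N)
  let ?S = "{v. \<exists>t. v(k + N := t) \<in> S}"
  have "determined (k + N) ?S"
    by (rule determined_project) (use Suc.prems in simp)
  then have "determined k {v. \<exists>z. (\<lambda>i. if k \<le> i \<and> i < k + N then z i else v i) \<in> ?S}"
    by (rule Suc.IH)
  moreover have iff: "(\<exists>z. (\<lambda>i. if k \<le> i \<and> i < k + N then z i else v i) \<in> ?S) \<longleftrightarrow>
    (\<exists>z. (\<lambda>i. if k \<le> i \<and> i < k + Suc N then z i else v i) \<in> S)" for v
  proof
    assume "\<exists>z. (\<lambda>i. if k \<le> i \<and> i < k + N then z i else v i) \<in> ?S"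
    then obtain z t where "(\<lambda>i. if k \<le> i \<and> i < k + N then z i else v i)(k + N := t) \<in> S" by blast
    moreover have "(\<lambda>i. if k \<le> i \<and> i < k + N then z i else v i)(k + N := t) =
      (\<lambda>i. if k \<le> i \<and> i < k + Suc N then (z(k + N := t)) i else v i)" by auto
    ultimately show "\<exists>z. (\<lambda>i. if k \<le> i \<and> i < k + Suc N then z i else v i) \<in> S" by metis
  next
    assume "\<exists>z. (\<lambda>i. if k \<le> i \<and> i < k + Suc N then z i else v i) \<in> S"
    then obtain z where "(\<lambda>i. if k \<le> i \<and> i < k + Suc N then z i else v i) \<in> S" by blast
    moreover have "(\<lambda>i. if k \<le> i \<and> i < k + N then z i else v i)(k + N := z (k + N)) =
      (\<lambda>i. if k \<le> i \<and> i < k + Suc N then z i else v i)" by auto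
    ultimately have "(\<lambda>i. if k \<le> i \<and> i < k + N then z i else v i)(k + N := z (k + N)) \<in> S" by simp
    then show "\<exists>z. (\<lambda>i. if k \<le> i \<and> i < k + N then z i else v i) \<in> ?S" by blast
  qed
  ultimately show ?case by (simp only: iff)
qed

lemma polyfun_1_poly: "f \<in> polyfun 1 \<Longrightarrow> \<exists>p. \<forall>v. f v = poly p (v 0)"
proof (induction rule: polyfun.induct)
  case (const c)
  show ?case by (intro exI[of _ "[:c:]"]) simp
next
  case (coord i)
  then show ?case by (intro exI[of _ "[:0, 1:]"]) simp
next
  case (add a b)
  then show ?case by (metis poly_add)
next
  case (mult a b)
  then show ?case by (metis poly_mult)
qed

lemma poly_sgn_eventually_const:
  fixes p :: "real poly"
  shows "\<exists>\<sigma>. \<forall>\<^sub>F t in at_right 0. sgn (poly p t) = \<sigma>"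
proof (cases "p = 0")
  case False
  define R where "R = insert 1 ({r. poly p r = 0} \<inter> {0<..})"
  have R: "finite R" "R \<noteq> {}" using poly_roots_finite[OF False] by (auto simp: R_def)
  define \<delta> where "\<delta> = Min R"
  have "\<delta> \<in> R" using R Min_in by (auto simp: \<delta>_def)
  then have \<delta>: "\<delta> > 0" by (auto simp: R_def)
  have nz: "poly p r \<noteq> 0" if "0 < r" "r < \<delta>" for r
    using that Min_le[OF R(1), of r] by (auto simp: R_def \<delta>_def)
  have "sgn (poly p t) = sgn (poly p (\<delta> / 2))" if "0 < t" "t < \<delta>" for t
  proof -
    have "sgn (poly p (max t (\<delta>/2))) = sgn (poly p (min t (\<delta>/2)))"
      by (rule poly_sgn_no_root[where t = "max t (\<delta>/2)"]) (use nz that \<delta> in auto)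
    then show ?thesis by (cases "t \<le> \<delta>/2") (auto simp: min_def max_def)
  qed
  then show ?thesis using \<delta> by (auto simp: eventually_at_right_field)
qed auto

lemma determined_1_eventually:
  assumes "determined 1 S"
  shows "(\<forall>\<^sub>F t in at_right 0. (\<lambda>_. t) \<in> S) \<or> (\<forall>\<^sub>F t in at_right 0. (\<lambda>_. t) \<notin> S)"
proof -
  obtain A where A: "finite A" "A \<subseteq> polyfun 1"
    and S: "\<forall>v w. (\<forall>a\<in>A. sgn (a v) = sgn (a w)) \<longrightarrow> v \<in> S \<longrightarrow> w \<in> S"
    using assms unfolding determined_def by (elim exE conjE)
  have "\<exists>\<sigma>. \<forall>\<^sub>F t in at_right 0. sgn (a (\<lambda>_. t)) = \<sigma>" if "a \<in> A" for a
  proof -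
    have "a \<in> polyfun 1" using A(2) that by (rule subsetD)
    from polyfun_1_poly[OF this] obtain p where "\<forall>v. a v = poly p (v 0)" by blast
    then show ?thesis using poly_sgn_eventually_const[of p] by simp
  qed
  then obtain \<sigma> where \<sigma>: "\<And>a. a \<in> A \<Longrightarrow> \<forall>\<^sub>F t in at_right 0. sgn (a (\<lambda>_. t)) = \<sigma> a" by metis
  have good: "\<forall>\<^sub>F t in at_right 0. \<forall>a\<in>A. sgn (a (\<lambda>_. t)) = \<sigma> a"
    using A(1) \<sigma> by (simp add: eventually_ball_finite_distrib)
  show ?thesis
  proof (cases "\<exists>t. (\<forall>a\<in>A. sgn (a (\<lambda>_. t)) = \<sigma> a) \<and> (\<lambda>_. t) \<in> S")
    case True
    then obtain t0 where t0: "\<forall>a\<in>A. sgn (a (\<lambda>_. t0)) = \<sigma> a" "(\<lambda>_. t0) \<in> S" by blast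
    have "\<forall>\<^sub>F t in at_right 0. (\<lambda>_. t) \<in> S"
      using good by eventually_elim (use S t0 in metis)
    then show ?thesis ..
  next
    case False
    have "\<forall>\<^sub>F t in at_right 0. (\<lambda>_. t) \<notin> S"
      using good by eventually_elim (use False in metis)
    then show ?thesis ..
  qed
qed

lemma semialgebraic_vimage:
  assumes "semialgebraic S" "polynomial_function f"
  shows "semialgebraic (f -` S)"
  using assms(1)
proof induction
  case (pos g)
  have "real_polynomial_function (g \<circ> f)"
    using pos assms(2) by (rule real_polynomial_function_compose[rotated])
  then have "semialgebraic {x. (g \<circ> f) x > 0}" by (rule semialgebraic.pos)
  then show ?case by (simp add: vimage_def)
next
  case (Compl A)
  then show ?case using semialgebraic.Compl by (simp add: vimage_Compl)
next
  case (Un A B)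
  then show ?case using semialgebraic.Un by (simp add: vimage_Un)
next
  case (Int A B)
  then show ?case using semialgebraic.Int by (simp add: vimage_Int)
qed

text \<open>The projection of a semialgebraic set to the line either contains or misses an interval
  \<open>(0, \<delta>)\<close>.\<close>

theorem semialgebraic_fst_eventually:
  fixes S :: "(real \<times> 'a::euclidean_space) set"
  assumes "semialgebraic S"
  shows "(\<forall>\<^sub>F t in at_right 0. \<exists>y. (t, y) \<in> S) \<or> (\<forall>\<^sub>F t in at_right 0. \<not> (\<exists>y. (t, y) \<in> S))"
proof -
  define N where "N = DIM('a)"
  obtain b :: "nat \<Rightarrow> 'a" where b: "bij_betw b {0..<N} Basis"
    using ex_bij_betw_nat_finite[OF finite_Basis] unfolding N_def by blast
  \<comment> \<open>Coordinate \<open>0\<close> is the line; the coordinates \<open>1, \<dots>, N\<close> are those of the fibre.\<close>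
  define pt where "pt v = (v 0, \<Sum>j<N. v (Suc j) *\<^sub>R b j)" for v :: "nat \<Rightarrow> real"
  have poly: "(\<lambda>v. f (pt v)) \<in> polyfun (Suc N)" if "real_polynomial_function f" for f
    using that
  proof induction
    case (linear f)
    then interpret bounded_linear f .
    have eq: "pt v = v 0 *\<^sub>R (1, 0) + (\<Sum>j<N. v (Suc j) *\<^sub>R (0, b j))" for v
      by (simp add: pt_def prod_eq_iff fst_sum snd_sum)
    have "f (pt v) = v 0 * f (1, 0) + (\<Sum>j<N. v (Suc j) * f (0, b j))" for v
      unfolding eq by (simp only: add sum scaleR real_scaleR_def)
    then show ?case
      by (auto intro!: polyfun.add polyfun.mult pf.sum polyfun.const polyfun.coord)
  qed (auto intro: polyfun.intros)
  have "determined (1 + N) {v. pt v \<in> S}"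
    using assms
  proof induction
    case (pos f)
    show ?case unfolding determined_def
    proof (intro exI[of _ "{\<lambda>v. f (pt v)}"] conjI allI impI)
      show "{\<lambda>v. f (pt v)} \<subseteq> polyfun (1 + N)" using poly[OF pos] by simp
      fix v w assume "\<forall>a\<in>{\<lambda>v. f (pt v)}. sgn (a v) = sgn (a w)"
      then have "sgn (f (pt v)) = sgn (f (pt w))" by simp
      moreover assume "v \<in> {v. pt v \<in> {x. f x > 0}}"
      ultimately show "w \<in> {v. pt v \<in> {x. f x > 0}}" using sgn_pos_iff by blast
    qed simp
  next
    case (Compl A)
    from determined_Compl[OF Compl.IH] show ?case by (simp add: Collect_neg_eq)
  next
    case (Un A B)
    from determined_Un[OF Un.IH] show ?case by (simp add: Collect_disj_eq)
  next
    case (Int A B)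
    from determined_Int[OF Int.IH] show ?case by (simp add: Collect_conj_eq)
  qed
  from determined_1_eventually[OF determined_project_many[OF this]]
  have ev: "(\<forall>\<^sub>F t in at_right 0. \<exists>z. pt (\<lambda>i. if 1 \<le> i \<and> i < 1 + N then z i else t) \<in> S) \<or>
    (\<forall>\<^sub>F t in at_right 0. \<not> (\<exists>z. pt (\<lambda>i. if 1 \<le> i \<and> i < 1 + N then z i else t) \<in> S))"
    by simp
  have "(\<exists>z. pt (\<lambda>i. if 1 \<le> i \<and> i < 1 + N then z i else t) \<in> S) \<longleftrightarrow> (\<exists>y. (t, y) \<in> S)" for t
  proof
    assume "\<exists>y. (t, y) \<in> S"
    then obtain y where y: "(t, y) \<in> S" by (elim exE)
    have "(\<Sum>j<N. (y \<bullet> b j) *\<^sub>R b j) = (\<Sum>u\<in>Basis. (y \<bullet> u) *\<^sub>R u)"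
      using sum.reindex_bij_betw[OF b, of "\<lambda>u. (y \<bullet> u) *\<^sub>R u"] by (simp add: lessThan_atLeast0)
    then have "pt (\<lambda>i. if 1 \<le> i \<and> i < 1 + N then y \<bullet> b (i - 1) else t) = (t, y)"
      by (simp add: pt_def euclidean_representation)
    then show "\<exists>z. pt (\<lambda>i. if 1 \<le> i \<and> i < 1 + N then z i else t) \<in> S" using y by metis
  qed (auto simp: pt_def)
  then show ?thesis using ev by simp
qed

corollary semialgebraic_family_eventually:
  fixes G :: "'a::euclidean_space set" and g :: "real \<times> 'a \<Rightarrow> real"
  assumes "semialgebraic G" "real_polynomial_function g"
  shows "(\<forall>\<^sub>F t in at_right 0. \<exists>z\<in>G. g (t, z) > 0) \<or> (\<forall>\<^sub>F t in at_right 0. \<not> (\<exists>z\<in>G. g (t, z) > 0))"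
proof -
  have "polynomial_function (snd :: real \<times> 'a \<Rightarrow> 'a)"
    by (rule polynomial_function_bounded_linear) (rule bounded_linear_snd)
  then have "semialgebraic (snd -` G \<inter> {x. g x > 0})"
    by (intro semialgebraic.Int semialgebraic_vimage semialgebraic.pos assms)
  from semialgebraic_fst_eventually[OF this] show ?thesis
    by (simp add: Bex_def)
qed

section \<open>The blow-up in coordinates\<close>

lemma sph_blowup_inv_eq:
  "y \<noteq> removed_pt p \<Longrightarrow> sph_blowup_inv p y =
    (case p of Some a \<Rightarrow> (sgn (y - a), norm (y - a)) | None \<Rightarrow> (sgn y, inverse (norm y)))"
  unfolding sph_blowup_inv_def
  by (rule the_inv_into_f_eq)
     (use bij_betw_sph_blowup[of p] in \<open>auto simp: bij_betw_def sph_blowup_def removed_pt_def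
       sgn_div_norm divide_inverse norm_sgn split: option.splits\<close>)

lemma sph_blowup_inv_sph_blowup:
  assumes "norm (fst z) = 1" "snd z > 0"
  shows "sph_blowup_inv p (sph_blowup p z) = z"
  unfolding sph_blowup_inv_def
  by (rule the_inv_into_f_f) (use bij_betw_sph_blowup[of p] assms in \<open>auto simp: bij_betw_def mem_Times_iff\<close>)

lemma sph_blowup_neq_removed_pt:
  assumes "norm (fst z) = 1" "snd z > 0"
  shows "sph_blowup p z \<noteq> removed_pt p"
  using assms by (cases z) (auto simp: sph_blowup_def removed_pt_def split: option.splits)

lemma sph_blowup_inv_props:
  assumes "y \<noteq> removed_pt p"
  shows "norm (fst (sph_blowup_inv p y)) = 1" "snd (sph_blowup_inv p y) > 0"
    "sph_blowup p (sph_blowup_inv p y) = y"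
  using assms by (auto simp: sph_blowup_inv_eq sph_blowup_def removed_pt_def norm_sgn
      sgn_div_norm split: option.splits)

lemma mem_strict_part:
  "z \<in> strict_part p X \<longleftrightarrow> norm (fst z) = 1 \<and> snd z > 0 \<and> sph_blowup p z \<in> X"
proof
  assume "z \<in> strict_part p X"
  then obtain x where x: "z = sph_blowup_inv p x" "x \<in> X" "x \<noteq> removed_pt p"
    by (auto simp: strict_part_def)
  then show "norm (fst z) = 1 \<and> snd z > 0 \<and> sph_blowup p z \<in> X"
    using sph_blowup_inv_props[OF x(3)] by simp
next
  assume z: "norm (fst z) = 1 \<and> snd z > 0 \<and> sph_blowup p z \<in> X"
  then have "z = sph_blowup_inv p (sph_blowup p z)" using sph_blowup_inv_sph_blowup by metis
  moreover have "sph_blowup p z \<in> X - {removed_pt p}" using z sph_blowup_neq_removed_pt by blast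
  ultimately show "z \<in> strict_part p X" unfolding strict_part_def by (rule image_eqI)
qed

lemma mem_strict_transf:
  assumes "z \<in> strict_transf p X"
  shows "norm (fst z) = 1 \<and> snd z \<ge> 0"
proof -
  have "closed {z :: 'a \<times> real. norm (fst z) = 1 \<and> snd z \<ge> 0}"
    by (intro closed_Collect_conj closed_Collect_eq closed_Collect_le continuous_intros)
  moreover have "strict_part p X \<subseteq> {z. norm (fst z) = 1 \<and> snd z \<ge> 0}"
    by (auto simp: mem_strict_part)
  ultimately show ?thesis
    using assms closure_minimal unfolding strict_transf_def by blast
qed

text \<open>The rescaling of space about \<open>p\<close> that turns \<open>\<rho>\<^sub>p(x, t)\<close> into \<open>x\<close>.\<close>

definition rescale :: "'a::real_normed_vector option \<Rightarrow> real \<Rightarrow> 'a \<Rightarrow> 'a" where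
  "rescale p t x = (case p of Some a \<Rightarrow> (x - a) /\<^sub>R t | None \<Rightarrow> t *\<^sub>R x)"

text \<open>The map read in the blow-up coordinates, without the normalisation of the direction:
  \<open>(\<phi>(tx + a) - b) / t\<close> at finite points and \<open>t \<phi>(x / t)\<close> at infinity.\<close>

definition rescaled_map ::
  "'a::real_normed_vector option \<Rightarrow> 'b::real_normed_vector option \<Rightarrow> ('a \<Rightarrow> 'b) \<Rightarrow> 'a \<times> real \<Rightarrow> 'b" where
  "rescaled_map p q \<phi> z = rescale q (snd z) (\<phi> (sph_blowup p z))"

text \<open>The radius in the blow-up at \<open>q\<close> of a point whose rescaling by \<open>r\<close> has norm \<open>s\<close>.\<close>

definition blowup_radius :: "'a option \<Rightarrow> real \<Rightarrow> real \<Rightarrow> real" where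
  "blowup_radius q r s = (case q of Some _ \<Rightarrow> r * s | None \<Rightarrow> r / s)"

lemma rescale_sph_blowup: "snd z > 0 \<Longrightarrow> rescale p (snd z) (sph_blowup p z) = fst z"
  by (auto simp: rescale_def sph_blowup_def split: option.splits prod.splits)

lemma rescale_eq_0_iff: "t > 0 \<Longrightarrow> rescale q t y = 0 \<longleftrightarrow> y = removed_pt q"
  by (auto simp: rescale_def removed_pt_def split: option.splits)

lemma sph_blowup_inv_rescale:
  assumes "t > 0" "rescale q t y \<noteq> 0"
  shows "sph_blowup_inv q y = (sgn (rescale q t y), blowup_radius q t (norm (rescale q t y)))"
proof -
  have "y \<noteq> removed_pt q" using assms rescale_eq_0_iff by blast
  then show ?thesis using assms
    by (auto simp: sph_blowup_inv_eq rescale_def blowup_radius_def sgn_scaleR divide_inverse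
        split: option.splits)
qed

lemma rescale_blowup_radius:
  fixes x :: "'a::real_normed_vector" and y :: "'b::real_normed_vector"
  assumes "t > 0" "y \<noteq> 0" "p = None \<longleftrightarrow> q = None"
  shows "rescale p (blowup_radius q t (norm y)) x = rescale p t x /\<^sub>R norm y"
  using assms by (cases p; cases q) (auto simp: rescale_def blowup_radius_def field_simps)

section \<open>Extension of a rescaled map to a homeomorphism\<close>

lemma dense_in_openin:
  assumes "openin (top_of_set (closure A)) U"
  shows "U \<subseteq> closure (U \<inter> A)"
proof -
  obtain T where T: "open T" "U = closure A \<inter> T" using assms by (auto simp: openin_open)
  then have "U \<subseteq> closure (T \<inter> A)" using open_Int_closure_subset[of T A] by blast
  also have "closure (T \<inter> A) \<subseteq> closure (U \<inter> A)"
    by (rule closure_mono) (use T closure_subset in auto)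
  finally show ?thesis .
qed

text \<open>One half of the construction: where the limit of the rescaled map does not vanish, the
  map in blow-up coordinates extends, and the rescaled inverse takes the expected values.\<close>

lemma blowup_extension:
  fixes A :: "('a::real_normed_vector \<times> real) set" and B :: "('b::real_normed_vector \<times> real) set"
    and q :: "'c option"
  assumes H: "continuous_on (closure A) H" and H': "continuous_on (closure B) H'"
    and AB: "\<forall>z\<in>A. H z \<noteq> 0 \<longrightarrow> (sgn (H z), blowup_radius q (snd z) (norm (H z))) \<in> B \<and>
      H' (sgn (H z), blowup_radius q (snd z) (norm (H z))) = fst z /\<^sub>R norm (H z)"
  defines "U \<equiv> {z \<in> closure A. H z \<noteq> 0}"
    and "\<Phi> \<equiv> \<lambda>z. (sgn (H z), blowup_radius q (snd z) (norm (H z)))"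
  shows "openin (top_of_set (closure A)) U" "continuous_on U \<Phi>"
    "z \<in> U \<Longrightarrow> \<Phi> z \<in> closure B \<and> H' (\<Phi> z) = fst z /\<^sub>R norm (H z)"
proof -
  have "openin (top_of_set (closure A)) (closure A \<inter> H -` (- {0}))"
    by (rule continuous_openin_preimage_gen[OF H]) auto
  moreover have "closure A \<inter> H -` (- {0}) = U" by (auto simp: U_def)
  ultimately show op: "openin (top_of_set (closure A)) U" by simp
  have HU: "continuous_on U H" using H by (rule continuous_on_subset) (auto simp: U_def)
  have nz: "H z \<noteq> 0" if "z \<in> U" for z using that by (simp add: U_def)
  show cont: "continuous_on U \<Phi>"
    unfolding \<Phi>_def blowup_radius_def sgn_div_norm
    by (cases q) (use nz in \<open>auto intro!: continuous_intros HU\<close>)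
  assume z: "z \<in> U"
  then obtain \<zeta> where \<zeta>: "\<And>n. \<zeta> n \<in> U \<inter> A" "\<zeta> \<longlonglongrightarrow> z"
    using dense_in_openin[OF op] closure_sequential by (metis subsetD)
  have "(\<lambda>n. \<Phi> (\<zeta> n)) \<longlonglongrightarrow> \<Phi> z"
    by (rule continuous_on_tendsto_compose[OF cont \<zeta>(2) z]) (use \<zeta>(1) in auto)
  moreover have \<zeta>B: "\<Phi> (\<zeta> n) \<in> B" "H' (\<Phi> (\<zeta> n)) = fst (\<zeta> n) /\<^sub>R norm (H (\<zeta> n))" for n
    using AB[rule_format, of "\<zeta> n"] \<zeta>(1)[of n] nz by (auto simp: \<Phi>_def)
  ultimately have cl: "\<Phi> z \<in> closure B"
    unfolding closure_sequential by (intro exI[of _ "\<lambda>n. \<Phi> (\<zeta> n)"]) simp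
  have "(\<lambda>n. H' (\<Phi> (\<zeta> n))) \<longlonglongrightarrow> H' (\<Phi> z)"
    by (rule continuous_on_tendsto_compose[OF H' \<open>(\<lambda>n. \<Phi> (\<zeta> n)) \<longlonglongrightarrow> \<Phi> z\<close> cl])
       (use \<zeta>B(1) closure_subset in \<open>auto intro!: always_eventually\<close>)
  moreover have "(\<lambda>n. fst (\<zeta> n) /\<^sub>R norm (H (\<zeta> n))) \<longlonglongrightarrow> fst z /\<^sub>R norm (H z)"
  proof (intro tendsto_intros \<zeta>(2))
    show "(\<lambda>n. H (\<zeta> n)) \<longlonglongrightarrow> H z"
      by (rule continuous_on_tendsto_compose[OF HU \<zeta>(2) z]) (use \<zeta>(1) in auto)
    show "norm (H z) \<noteq> 0" using nz[OF z] by simp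
  qed
  ultimately have "H' (\<Phi> z) = fst z /\<^sub>R norm (H z)"
    using \<zeta>B(2) LIMSEQ_unique by auto
  then show "\<Phi> z \<in> closure B \<and> H' (\<Phi> z) = fst z /\<^sub>R norm (H z)" using cl by blast
qed

lemma blowup_extension_inverse:
  fixes z :: "'a::real_normed_vector \<times> real" and y :: "'b::real_normed_vector"
  assumes "norm (fst z) = 1" "y \<noteq> 0" "x = fst z /\<^sub>R norm y" "p = None \<longleftrightarrow> q = None"
  shows "x \<noteq> 0" "(sgn x, blowup_radius p (blowup_radius q (snd z) (norm y)) (norm x)) = z"
proof -
  show "x \<noteq> 0" using assms by auto
  have "sgn (fst z) = fst z" using assms(1) by (simp add: sgn_div_norm)
  then show "(sgn x, blowup_radius p (blowup_radius q (snd z) (norm y)) (norm x)) = z"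
    using assms by (cases z; cases p; cases q) (auto simp: blowup_radius_def sgn_scaleR)
qed

text \<open>The sets \<open>A\<close> and \<open>B\<close> stand for the strict parts. The map \<open>\<Phi>\<close> is given by the same formula on
  the closure as on \<open>A\<close>; it is invertible where the rescaled maps do not vanish.\<close>

lemma blowup_homeomorphism:
  fixes A :: "('a::real_normed_vector \<times> real) set" and B :: "('b::real_normed_vector \<times> real) set"
    and p :: "'c option" and q :: "'d option"
  assumes H: "continuous_on (closure A) H" and H': "continuous_on (closure B) H'"
    and pq: "p = None \<longleftrightarrow> q = None"
    and A: "\<And>z. z \<in> closure A \<Longrightarrow> norm (fst z) = 1" and B: "\<And>z. z \<in> closure B \<Longrightarrow> norm (fst z) = 1"
    and AB: "\<forall>z\<in>A. H z \<noteq> 0 \<longrightarrow> (sgn (H z), blowup_radius q (snd z) (norm (H z))) \<in> B \<and>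
      H' (sgn (H z), blowup_radius q (snd z) (norm (H z))) = fst z /\<^sub>R norm (H z)"
    and BA: "\<forall>z\<in>B. H' z \<noteq> 0 \<longrightarrow> (sgn (H' z), blowup_radius p (snd z) (norm (H' z))) \<in> A \<and>
      H (sgn (H' z), blowup_radius p (snd z) (norm (H' z))) = fst z /\<^sub>R norm (H' z)"
  defines "U \<equiv> {z \<in> closure A. H z \<noteq> 0}" and "V \<equiv> {z \<in> closure B. H' z \<noteq> 0}"
    and "\<Phi> \<equiv> \<lambda>z. (sgn (H z), blowup_radius q (snd z) (norm (H z)))"
    and "\<Psi> \<equiv> \<lambda>z. (sgn (H' z), blowup_radius p (snd z) (norm (H' z)))"
  shows "homeomorphism U V \<Phi> \<Psi>" "\<Phi> ` (U \<inter> A) = V \<inter> B"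
proof -
  note ext = blowup_extension[OF H H' AB, folded U_def \<Phi>_def]
  note ext' = blowup_extension[OF H' H BA, folded V_def \<Psi>_def]
  have 1: "\<Phi> z \<in> V \<and> \<Psi> (\<Phi> z) = z" if "z \<in> U" for z
    using ext(3)[OF that] blowup_extension_inverse[of z "H z" "H' (\<Phi> z)" p q] that pq A
    by (auto simp: U_def V_def \<Phi>_def \<Psi>_def)
  have 2: "\<Psi> z \<in> U \<and> \<Phi> (\<Psi> z) = z" if "z \<in> V" for z
    using ext'(3)[OF that] blowup_extension_inverse[of z "H' z" "H (\<Psi> z)" q p] that pq B
    by (auto simp: U_def V_def \<Phi>_def \<Psi>_def)
  show "homeomorphism U V \<Phi> \<Psi>"
  proof (rule homeomorphismI[OF ext(2) ext'(2)])
  qed (use 1 2 in auto)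
  show "\<Phi> ` (U \<inter> A) = V \<inter> B"
  proof
    show "\<Phi> ` (U \<inter> A) \<subseteq> V \<inter> B" using 1 AB by (auto simp: U_def \<Phi>_def)
    show "V \<inter> B \<subseteq> \<Phi> ` (U \<inter> A)"
    proof
      fix z assume z: "z \<in> V \<inter> B"
      then have "\<Psi> z \<in> A" using BA by (auto simp: V_def \<Psi>_def)
      then show "z \<in> \<Phi> ` (U \<inter> A)" using 2 z by (metis IntD1 IntI image_eqI)
    qed
  qed
qed

section \<open>Limits of the rescaled map\<close>

lemma bounded_imp_cluster_point:
  fixes f :: "'a \<Rightarrow> 'b::euclidean_space"
  assumes "F \<noteq> bot" "\<forall>\<^sub>F z in F. norm (f z) \<le> M"
  shows "\<exists>w. \<forall>e>0. \<exists>\<^sub>F z in F. dist (f z) w < e"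
proof -
  have "\<forall>\<^sub>F y in filtermap f F. y \<in> cball 0 M"
    using assms(2) by (simp add: eventually_filtermap)
  moreover have "filtermap f F \<noteq> bot" using assms(1) by (simp add: filtermap_bot_iff)
  ultimately obtain w where w: "inf (nhds w) (filtermap f F) \<noteq> bot"
    using compact_filter[of "cball (0::'b) M"] compact_cball by blast
  have "\<exists>\<^sub>F z in F. dist (f z) w < e" if "e > 0" for e
  proof (rule ccontr)
    assume "\<not> (\<exists>\<^sub>F z in F. dist (f z) w < e)"
    then have "\<forall>\<^sub>F y in filtermap f F. \<not> dist y w < e"
      by (simp add: eventually_filtermap not_frequently)
    moreover have "\<forall>\<^sub>F y in nhds w. dist y w < e"
      using that eventually_nhds_metric by blast
    ultimately have "\<forall>\<^sub>F y in inf (nhds w) (filtermap f F). False"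
      by (auto simp: eventually_inf)
    then show False using w by (simp add: eventually_False)
  qed
  then show ?thesis by blast
qed

lemma unique_cluster_point_imp_tendsto:
  fixes f :: "'a \<Rightarrow> 'b::euclidean_space"
  assumes "\<forall>\<^sub>F z in F. norm (f z) \<le> M"
    and unique: "\<And>w w'. \<lbrakk>\<forall>e>0. \<exists>\<^sub>F z in F. dist (f z) w < e; \<forall>e>0. \<exists>\<^sub>F z in F. dist (f z) w' < e\<rbrakk> \<Longrightarrow> w = w'"
  shows "\<exists>l. (f \<longlongrightarrow> l) F"
proof (cases "F = bot")
  case False
  obtain w where w: "\<forall>e>0. \<exists>\<^sub>F z in F. dist (f z) w < e"
    using bounded_imp_cluster_point[OF False assms(1)] by blast
  have "(f \<longlongrightarrow> w) F"
  proof (rule tendstoI, rule ccontr)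
    fix e :: real assume e: "e > 0" and not: "\<not> (\<forall>\<^sub>F z in F. dist (f z) w < e)"
    define G where "G = inf F (principal {z. \<not> dist (f z) w < e})"
    have ev: "eventually P G \<longleftrightarrow> (\<forall>\<^sub>F z in F. \<not> dist (f z) w < e \<longrightarrow> P z)" for P
      by (simp add: G_def eventually_inf_principal)
    have "G \<noteq> bot" using not ev[of "\<lambda>_. False"] by (auto simp: trivial_limit_def)
    moreover have "\<forall>\<^sub>F z in G. norm (f z) \<le> M"
      unfolding ev using assms(1) by (rule eventually_mono) simp
    ultimately obtain w' where w': "\<forall>e>0. \<exists>\<^sub>F z in G. dist (f z) w' < e"
      using bounded_imp_cluster_point by blast
    have "G \<le> F" by (simp add: G_def)
    then have "\<forall>e>0. \<exists>\<^sub>F z in F. dist (f z) w' < e"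
      using w' unfolding frequently_def by (meson filter_leD)
    then have "w = w'" using unique w by blast
    then have "\<exists>\<^sub>F z in G. dist (f z) w < e" using w' e by blast
    moreover have "\<forall>\<^sub>F z in G. \<not> dist (f z) w < e" unfolding ev by simp
    ultimately show False by (simp add: frequently_def)
  qed
  then show ?thesis ..
qed auto

lemma real_polynomial_function_norm_sq:
  fixes f :: "'a::euclidean_space \<Rightarrow> 'b::euclidean_space"
  assumes "polynomial_function f"
  shows "real_polynomial_function (\<lambda>x. (norm (f x))\<^sup>2)"
proof -
  have "(\<lambda>x. (norm (f x))\<^sup>2) = (\<lambda>x. \<Sum>b\<in>Basis. (f x \<bullet> b)\<^sup>2)"
    by (rule ext) (simp only: power2_norm_eq_inner, subst euclidean_inner, simp add: power2_eq_square)
  moreover have "real_polynomial_function (\<lambda>x. \<Sum>b\<in>Basis. (f x \<bullet> b)\<^sup>2)"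
    using assms unfolding polynomial_function_iff_Basis_inner
    by (intro real_polynomial_function_sum real_polynomial_function_power finite_Basis) blast
  ultimately show ?thesis by simp
qed

text \<open>Whether \<open>G\<close>, rescaled about \<open>(p, q)\<close> by \<open>t\<close>, comes close to \<open>(v, w)\<close> does not depend on \<open>t\<close> once \<open>t\<close> is
  small. After multiplication by \<open>t\<^sup>2\<close> in the finite case, the condition is polynomial.\<close>

lemma semialgebraic_rescale_eventually:
  fixes G :: "('a::euclidean_space \<times> 'b::euclidean_space) set"
    and v :: 'a and w :: 'b and \<epsilon> :: real
  assumes G: "semialgebraic G" and pq: "p = None \<longleftrightarrow> q = None"
  defines "P t \<equiv> \<exists>(x, y)\<in>G. (norm (rescale p t x - v))\<^sup>2 + (norm (rescale q t y - w))\<^sup>2 < \<epsilon>"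
  shows "(\<forall>\<^sub>F t in at_right 0. P t) \<or> (\<forall>\<^sub>F t in at_right 0. \<not> P t)"
proof -
  have pos: "\<forall>\<^sub>F t::real in at_right 0. t > 0" by (simp add: eventually_at_right_less)
  have poly1: "real_polynomial_function (\<lambda>z :: real \<times> 'a \<times> 'b. fst z)"
    by (rule real_polynomial_function.intros(1)) (rule bounded_linear_fst)
  have poly: "polynomial_function (\<lambda>z :: real \<times> 'a \<times> 'b. fst z)"
    "polynomial_function (\<lambda>z :: real \<times> 'a \<times> 'b. fst (snd z))"
    "polynomial_function (\<lambda>z :: real \<times> 'a \<times> 'b. snd (snd z))"
    by (intro polynomial_function_bounded_linear bounded_linear_intros)+
  obtain g :: "real \<times> 'a \<times> 'b \<Rightarrow> real" where g: "real_polynomial_function g"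
    "\<And>t x y. t > 0 \<Longrightarrow> g (t, x, y) > 0 \<longleftrightarrow> (norm (rescale p t x - v))\<^sup>2 + (norm (rescale q t y - w))\<^sup>2 < \<epsilon>"
  proof (cases p)
    case None
    then have q: "q = None" using pq by simp
    show ?thesis
    proof
      show "real_polynomial_function (\<lambda>z. \<epsilon> - ((norm (fst z *\<^sub>R fst (snd z) - v))\<^sup>2 +
          (norm (fst z *\<^sub>R snd (snd z) - w))\<^sup>2))"
        by (intro real_polynomial_function_diff real_polynomial_function.intros(2) real_polynomial_function.intros(3)
            real_polynomial_function_norm_sq polynomial_function_diff polynomial_function_mult poly
            polynomial_function_const)
    qed (auto simp: rescale_def None q)
  next
    case (Some a)
    then obtain b where q: "q = Some b" using pq by (cases q) auto
    show ?thesis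
    proof
      show "real_polynomial_function (\<lambda>z. \<epsilon> * (fst z)\<^sup>2 - ((norm (fst (snd z) - a - fst z *\<^sub>R v))\<^sup>2 +
          (norm (snd (snd z) - b - fst z *\<^sub>R w))\<^sup>2))"
        by (intro real_polynomial_function_diff real_polynomial_function.intros(2) real_polynomial_function.intros(3)
            real_polynomial_function.intros(4) real_polynomial_function_power poly1
            real_polynomial_function_norm_sq polynomial_function_diff polynomial_function_mult poly
            polynomial_function_const)
      fix t :: real and x y assume t: "t > 0"
      have sc: "norm (u - t *\<^sub>R c) = t * norm (u /\<^sub>R t - c)" for u c :: "'c::real_normed_vector"
      proof -
        have "u - t *\<^sub>R c = t *\<^sub>R (u /\<^sub>R t - c)" using t by (simp add: scaleR_diff_right)
        then show ?thesis using t by simp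
      qed
      show "0 < \<epsilon> * (fst (t, x, y))\<^sup>2 - ((norm (fst (snd (t, x, y)) - a - fst (t, x, y) *\<^sub>R v))\<^sup>2 +
          (norm (snd (snd (t, x, y)) - b - fst (t, x, y) *\<^sub>R w))\<^sup>2) \<longleftrightarrow>
        (norm (rescale p t x - v))\<^sup>2 + (norm (rescale q t y - w))\<^sup>2 < \<epsilon>"
        using t by (simp add: rescale_def Some q sc power_mult_distrib mult.commute[of \<epsilon>]
            flip: distrib_left)
    qed
  qed
  have iff: "\<forall>\<^sub>F t in at_right 0. (\<exists>z\<in>G. g (t, z) > 0) \<longleftrightarrow> P t"
    using pos
  proof eventually_elim
    case (elim t)
    have "g (t, z) > 0 \<longleftrightarrow>
        (case z of (x, y) \<Rightarrow> (norm (rescale p t x - v))\<^sup>2 + (norm (rescale q t y - w))\<^sup>2 < \<epsilon>)" for z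
      using g(2)[OF elim] by (cases z) simp
    then show ?case by (simp only: P_def)
  qed
  show ?thesis
    using semialgebraic_family_eventually[OF G g(1)]
  proof
    assume "\<forall>\<^sub>F t in at_right 0. \<exists>z\<in>G. g (t, z) > 0"
    with iff have "\<forall>\<^sub>F t in at_right 0. P t" by eventually_elim simp
    then show ?thesis ..
  next
    assume "\<forall>\<^sub>F t in at_right 0. \<not> (\<exists>z\<in>G. g (t, z) > 0)"
    with iff have "\<forall>\<^sub>F t in at_right 0. \<not> P t" by eventually_elim simp
    then show ?thesis ..
  qed
qed

text \<open>\<open>\<phi>\<close> is Lipschitz on \<open>X\<close> and remains so, with the same constant, when the value \<open>q\<close> at the finite
  point \<open>p\<close> is added. For \<open>p = \<infinity>\<close> it is only required that \<open>q = \<infinity>\<close>.\<close>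

definition lipschitz_pair ::
  "real \<Rightarrow> 'a::real_normed_vector set \<Rightarrow> ('a \<Rightarrow> 'b::real_normed_vector) \<Rightarrow> 'a option \<Rightarrow> 'b option \<Rightarrow> bool" where
  "lipschitz_pair L X \<phi> p q \<longleftrightarrow> L-lipschitz_on X \<phi> \<and> (p = None \<longleftrightarrow> q = None) \<and>
     (\<forall>a b. p = Some a \<longrightarrow> q = Some b \<longrightarrow> (\<forall>x\<in>X. norm (\<phi> x - b) \<le> L * norm (x - a)))"

lemma lipschitz_pair_norm_le:
  assumes "lipschitz_pair L X \<phi> p q" "x \<in> X" "y \<in> X"
  shows "norm (\<phi> x - \<phi> y) \<le> L * norm (x - y)"
  using assms lipschitz_onD[of L X \<phi> x y] by (simp add: lipschitz_pair_def dist_norm)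

lemma rescale_lipschitz:
  assumes "lipschitz_pair L X \<phi> p q" "x \<in> X" "y \<in> X" "t > 0"
  shows "norm (rescale q t (\<phi> x) - rescale q t (\<phi> y)) \<le> L * norm (rescale p t x - rescale p t y)"
proof -
  have "norm (\<phi> x - \<phi> y) \<le> L * norm (x - y)"
    using assms lipschitz_pair_norm_le by blast
  moreover have "(x - a) /\<^sub>R t - (y - a) /\<^sub>R t = (x - y) /\<^sub>R t" for x y a :: "'c::real_vector"
    by (simp flip: scaleR_diff_right)
  ultimately show ?thesis using assms
    by (cases p; cases q)
       (auto simp: rescale_def lipschitz_pair_def mult.left_commute[of L] simp flip: scaleR_diff_right)
qed

text \<open>The additive error \<open>C t\<close> is needed only at infinity, where it comes from a base point of \<open>X\<close>.\<close>

lemma rescale_bound: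
  assumes "lipschitz_pair L X \<phi> p q"
  shows "\<exists>C. \<forall>x\<in>X. \<forall>t>0. norm (rescale q t (\<phi> x)) \<le> L * norm (rescale p t x) + C * t"
proof (cases "X = {} \<or> p \<noteq> None")
  case True
  have "norm (rescale q t (\<phi> x)) \<le> L * norm (rescale p t x) + 0 * t" if "x \<in> X" "t > 0" for x t
    using that True assms
    by (cases p; cases q) (auto simp: rescale_def lipschitz_pair_def mult.left_commute[of L])
  then show ?thesis by blast
next
  case False
  then obtain x0 where x0: "x0 \<in> X" and pq: "p = None" "q = None"
    using assms by (auto simp: lipschitz_pair_def)
  have L: "L \<ge> 0" using assms lipschitz_on_nonneg unfolding lipschitz_pair_def by blast
  have bound: "norm (\<phi> x) \<le> L * norm x + (L * norm x0 + norm (\<phi> x0))" if "x \<in> X" for x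
  proof -
    have "norm (\<phi> x) \<le> norm (\<phi> x - \<phi> x0) + norm (\<phi> x0)" by norm
    also have "norm (\<phi> x - \<phi> x0) \<le> L * norm (x - x0)"
      using assms x0 that lipschitz_pair_norm_le by blast
    also have "\<dots> \<le> L * (norm x + norm x0)" using L by (intro mult_left_mono norm_triangle_ineq4)
    finally show ?thesis by (simp add: algebra_simps)
  qed
  have "norm (rescale q t (\<phi> x)) \<le> L * norm (rescale p t x) + (L * norm x0 + norm (\<phi> x0)) * t"
    if "x \<in> X" "t > 0" for x t
  proof -
    have "t * norm (\<phi> x) \<le> t * (L * norm x + (L * norm x0 + norm (\<phi> x0)))"
      using bound[OF that(1)] that(2) by (intro mult_left_mono) auto
    then show ?thesis using that(2) by (simp add: rescale_def pq algebra_simps)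
  qed
  then show ?thesis by blast
qed

lemma tendsto_snd_strict_part:
  assumes "snd z0 = 0"
  shows "filterlim snd (at_right 0) (at z0 within strict_part p X)"
proof -
  have "(snd \<longlongrightarrow> snd z0) (at z0 within strict_part p X)" by (intro tendsto_intros)
  moreover have "\<forall>\<^sub>F z in at z0 within strict_part p X. snd z \<in> {0<..} \<and> snd z \<noteq> 0"
    by (auto simp: eventually_at_filter mem_strict_part)
  ultimately show ?thesis using assms by (simp add: filterlim_at eventually_conj_iff)
qed

text \<open>At a boundary direction the rescaled map has only one cluster point. If \<open>w\<close> is one, then
  \<open>(v, w)\<close> is a tangent direction of the graph at \<open>(p, q)\<close>; as the graph is semialgebraic, the
  graph comes close to it at every small scale \<open>t\<close>. For two cluster points, points of the
  graph at one common scale can thus be compared by means of the Lipschitz condition.\<close>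

lemma rescaled_map_boundary_limit:
  fixes X :: "'a::euclidean_space set" and \<phi> :: "'a \<Rightarrow> 'b::euclidean_space"
  assumes sa: "semialgebraic_map_on X \<phi>" and lip: "lipschitz_pair L X \<phi> p q" and z0: "snd z0 = 0"
  shows "\<exists>l. (rescaled_map p q \<phi> \<longlongrightarrow> l) (at z0 within strict_part p X)"
proof -
  define F where "F = at z0 within strict_part p X"
  have L: "L \<ge> 0" using lip lipschitz_on_nonneg unfolding lipschitz_pair_def by blast
  have pq: "p = None \<longleftrightarrow> q = None" using lip by (simp add: lipschitz_pair_def)
  have FA: "\<forall>\<^sub>F z in F. z \<in> strict_part p X" by (simp add: F_def eventually_at_filter)
  have Fsnd: "filterlim snd (at_right 0) F" unfolding F_def by (rule tendsto_snd_strict_part[OF z0])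
  have Fd: "\<forall>\<^sub>F z in F. dist z z0 < e" if "e > 0" for e
    using tendsto_ident_at[of z0 "strict_part p X"] that unfolding F_def tendsto_iff by blast
  obtain C where C: "\<And>x t. x \<in> X \<Longrightarrow> t > 0 \<Longrightarrow> norm (rescale q t (\<phi> x)) \<le> L * norm (rescale p t x) + C * t"
    using rescale_bound[OF lip] by blast
  have bd: "norm (rescaled_map p q \<phi> z) \<le> L + C * snd z" if "z \<in> strict_part p X" for z
    using C[of "sph_blowup p z" "snd z"] that rescale_sph_blowup[of z p]
    by (simp add: mem_strict_part rescaled_map_def)
  have "\<forall>\<^sub>F z in F. norm (rescaled_map p q \<phi> z) \<le> L + \<bar>C\<bar>"
    using FA Fd[of 1, simplified]
  proof eventually_elim
    case (elim z)
    have "\<bar>snd z\<bar> \<le> dist z z0" using dist_snd_le[of z z0] z0 by (simp add: dist_real_def)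
    then have "\<bar>C\<bar> * \<bar>snd z\<bar> \<le> \<bar>C\<bar> * 1" using elim(2) by (intro mult_left_mono) auto
    then have "C * snd z \<le> \<bar>C\<bar>" using abs_ge_self[of "C * snd z"] by (simp add: abs_mult)
    then show ?case using bd[OF elim(1)] by simp
  qed
  then show ?thesis unfolding F_def[symmetric]
  proof (rule unique_cluster_point_imp_tendsto)
    fix w w'
    assume w: "\<forall>e>0. \<exists>\<^sub>F z in F. dist (rescaled_map p q \<phi> z) w < e"
      and w': "\<forall>e>0. \<exists>\<^sub>F z in F. dist (rescaled_map p q \<phi> z) w' < e"
    define G where "G = (\<lambda>x. (x, \<phi> x)) ` X"
    have G: "semialgebraic G" using sa by (simp add: G_def semialgebraic_map_on_def)
    have near: "\<forall>\<^sub>F t in at_right 0. \<exists>x\<in>X. norm (rescale p t x - fst z0) < e \<and> norm (rescale q t (\<phi> x) - u) < e"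
      if "e > 0" and u: "\<forall>e>0. \<exists>\<^sub>F z in F. dist (rescaled_map p q \<phi> z) u < e" for e u
    proof -
      define P where "P t \<longleftrightarrow> (\<exists>(x, y)\<in>G. (norm (rescale p t x - fst z0))\<^sup>2 + (norm (rescale q t y - u))\<^sup>2 < e\<^sup>2)" for t
      have "\<exists>\<^sub>F z in F. P (snd z)"
      proof -
        have "\<exists>\<^sub>F z in F. dist (rescaled_map p q \<phi> z) u < e / 2"
          using u[rule_format, OF half_gt_zero[OF \<open>e > 0\<close>]] .
        moreover have "\<forall>\<^sub>F z in F. dist (rescaled_map p q \<phi> z) u < e / 2 \<longrightarrow> P (snd z)"
          using Fd[OF half_gt_zero[OF \<open>e > 0\<close>]] FA
        proof (eventually_elim, intro impI)
          fix z assume z: "dist z z0 < e / 2" "z \<in> strict_part p X"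
            "dist (rescaled_map p q \<phi> z) u < e / 2"
          let ?x = "sph_blowup p z"
          have x: "?x \<in> X" "snd z > 0" using z by (auto simp: mem_strict_part)
          have "norm (rescale p (snd z) ?x - fst z0) < e / 2"
            using dist_fst_le[of z z0] z rescale_sph_blowup[OF x(2), of p] by (simp add: dist_norm)
          moreover have "norm (rescale q (snd z) (\<phi> ?x) - u) < e / 2"
            using z by (simp add: rescaled_map_def dist_norm)
          ultimately have "(norm (rescale p (snd z) ?x - fst z0))\<^sup>2 + (norm (rescale q (snd z) (\<phi> ?x) - u))\<^sup>2
              \<le> (e / 2)\<^sup>2 + (e / 2)\<^sup>2"
            by (intro add_mono power_mono) auto
          also have "\<dots> < e\<^sup>2" using \<open>e > 0\<close> by (simp add: power2_eq_square)
          finally show "P (snd z)" using x by (auto simp: P_def G_def)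
        qed
        ultimately show ?thesis by (rule frequently_rev_mp)
      qed
      then have "\<exists>\<^sub>F t in at_right 0. P t"
        using Fsnd unfolding frequently_def filterlim_iff by blast
      then have "\<forall>\<^sub>F t in at_right 0. P t"
        using semialgebraic_rescale_eventually[OF G pq, of "fst z0" u "e\<^sup>2"]
        unfolding P_def frequently_def by blast
      then show ?thesis
      proof (rule eventually_mono)
        fix t assume "P t"
        then obtain x where x: "x \<in> X"
          "(norm (rescale p t x - fst z0))\<^sup>2 + (norm (rescale q t (\<phi> x) - u))\<^sup>2 < e\<^sup>2"
          by (auto simp: P_def G_def)
        have "(norm (rescale p t x - fst z0))\<^sup>2 < e\<^sup>2" "(norm (rescale q t (\<phi> x) - u))\<^sup>2 < e\<^sup>2"
          using x(2) by (smt (verit) zero_le_power2)+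
        then show "\<exists>x\<in>X. norm (rescale p t x - fst z0) < e \<and> norm (rescale q t (\<phi> x) - u) < e"
          using x(1) \<open>e > 0\<close> power_less_imp_less_base by (metis less_imp_le)
      qed
    qed
    have "dist w w' \<le> (2 + 2 * L) * e" if "e > 0" for e
    proof -
      have "\<forall>\<^sub>F t::real in at_right 0. t > 0" by (simp add: eventually_at_right_less)
      with near[OF that w] near[OF that w'] have "\<forall>\<^sub>F t::real in at_right 0. t > 0 \<and>
         (\<exists>x\<in>X. norm (rescale p t x - fst z0) < e \<and> norm (rescale q t (\<phi> x) - w) < e) \<and>
         (\<exists>x\<in>X. norm (rescale p t x - fst z0) < e \<and> norm (rescale q t (\<phi> x) - w') < e)"
        by eventually_elim blast
      then obtain t x x' where t: "t > 0" and x: "x \<in> X" "norm (rescale p t x - fst z0) < e"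
          "norm (rescale q t (\<phi> x) - w) < e"
        and x': "x' \<in> X" "norm (rescale p t x' - fst z0) < e" "norm (rescale q t (\<phi> x') - w') < e"
        using eventually_happens'[OF trivial_limit_at_right_real] by blast
      have "norm (rescale p t x - rescale p t x') \<le> 2 * e" using x(2) x'(2) by norm
      then have "L * norm (rescale p t x - rescale p t x') \<le> L * (2 * e)"
        using L by (rule mult_left_mono)
      then have "norm (rescale q t (\<phi> x) - rescale q t (\<phi> x')) \<le> 2 * L * e"
        using rescale_lipschitz[OF lip x(1) x'(1) t] by simp
      then have "norm (w - w') \<le> 2 * e + 2 * L * e" using x(3) x'(3) by norm
      then show ?thesis by (simp add: dist_norm algebra_simps)
    qed
    note le = this
    show "w = w'"
    proof (rule ccontr)
      assume "w \<noteq> w'"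
      then have d: "dist w w' > 0" by simp
      moreover have K: "2 + 2 * L > 0" using L by simp
      ultimately have "dist w w' \<le> (2 + 2 * L) * (dist w w' / 2 / (2 + 2 * L))"
        by (intro le divide_pos_pos) simp_all
      also have "\<dots> = dist w w' / 2"
        using K by (metis less_irrefl nonzero_mult_div_cancel_left times_divide_eq_right)
      finally show False using d by simp
    qed
  qed
qed

lemma tendsto_sph_blowup:
  assumes "snd z0 > 0"
  shows "(sph_blowup p \<longlongrightarrow> sph_blowup p z0) (at z0 within A)"
proof -
  have "sph_blowup p = (\<lambda>z. case p of Some a \<Rightarrow> snd z *\<^sub>R fst z + a | None \<Rightarrow> fst z /\<^sub>R snd z)"
    by (auto simp: sph_blowup_def fun_eq_iff split: option.splits)
  then show ?thesis using assms by (cases p) (auto intro!: tendsto_eq_intros)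
qed

text \<open>At positive radius, the extension of \<open>\<phi>\<close> to the closure of \<open>X\<close> provides the limit.\<close>

lemma rescaled_map_interior_limit:
  assumes g: "continuous_on (closure X) g" and eq: "\<And>x. x \<in> X \<Longrightarrow> g x = \<phi> x"
    and z0: "z0 \<in> strict_transf p X" "snd z0 > 0"
  shows "(rescaled_map p q \<phi> \<longlongrightarrow> rescale q (snd z0) (g (sph_blowup p z0))) (at z0 within strict_part p X)"
proof -
  obtain \<zeta> where \<zeta>: "\<And>n. \<zeta> n \<in> strict_part p X" "\<zeta> \<longlonglongrightarrow> z0"
    using z0(1) unfolding strict_transf_def closure_sequential by blast
  have "isCont (sph_blowup p) z0"
    using tendsto_sph_blowup[OF z0(2), of p UNIV] by (simp add: isCont_def)
  then have "(\<lambda>n. sph_blowup p (\<zeta> n)) \<longlonglongrightarrow> sph_blowup p z0" using \<zeta>(2) by (rule isCont_tendsto_compose)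
  moreover have "sph_blowup p (\<zeta> n) \<in> X" for n using \<zeta>(1)[of n] by (simp add: mem_strict_part)
  ultimately have cl: "sph_blowup p z0 \<in> closure X"
    unfolding closure_sequential by (intro exI[of _ "\<lambda>n. sph_blowup p (\<zeta> n)"]) simp
  have A: "\<forall>\<^sub>F z in at z0 within strict_part p X. z \<in> strict_part p X"
    by (simp add: eventually_at_filter)
  have "((\<lambda>z. g (sph_blowup p z)) \<longlongrightarrow> g (sph_blowup p z0)) (at z0 within strict_part p X)"
  proof (rule continuous_on_tendsto_compose[OF g tendsto_sph_blowup[OF z0(2)] cl])
    show "\<forall>\<^sub>F z in at z0 within strict_part p X. sph_blowup p z \<in> closure X"
      using A by (rule eventually_mono) (use closure_subset in \<open>auto simp: mem_strict_part\<close>)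
  qed
  then have "((\<lambda>z. rescale q (snd z) (g (sph_blowup p z))) \<longlongrightarrow> rescale q (snd z0) (g (sph_blowup p z0)))
      (at z0 within strict_part p X)"
    unfolding rescale_def using z0(2) by (cases q) (auto intro!: tendsto_eq_intros)
  then show ?thesis
  proof (rule tendsto_cong[THEN iffD1, rotated])
    show "\<forall>\<^sub>F z in at z0 within strict_part p X.
        rescale q (snd z) (g (sph_blowup p z)) = rescaled_map p q \<phi> z"
      using A by (rule eventually_mono) (simp add: rescaled_map_def mem_strict_part eq)
  qed
qed

lemma atin_within_euclidean: "atin_within euclidean z S = at z within S"
  by (auto simp: filter_eq_iff eventually_atin_within eventually_at_topological)

lemma rescaled_map_extension:
  fixes X :: "'a::euclidean_space set" and \<phi> :: "'a \<Rightarrow> 'b::euclidean_space"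
  assumes sa: "semialgebraic_map_on X \<phi>" and lip: "lipschitz_pair L X \<phi> p q"
  shows "\<exists>H. continuous_on (strict_transf p X) H \<and> (\<forall>z\<in>strict_part p X. H z = rescaled_map p q \<phi> z)"
proof -
  have "L-lipschitz_on X \<phi>" using lip by (simp add: lipschitz_pair_def)
  then obtain g where g: "L-lipschitz_on (closure X) g" "\<And>x. x \<in> X \<Longrightarrow> g x = \<phi> x"
    using lipschitz_extend_closure by blast
  then have gc: "continuous_on (closure X) g" using lipschitz_on_continuous_on by blast
  have sub: "strict_part p X \<subseteq> strict_transf p X" by (simp add: strict_transf_def closure_subset)
  have "continuous_on (strict_part p X) (rescaled_map p q \<phi>)"
    unfolding continuous_on_def
  proof
    fix z assume z: "z \<in> strict_part p X"
    then have "rescaled_map p q \<phi> z = rescale q (snd z) (g (sph_blowup p z))"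
      by (simp add: rescaled_map_def g(2) mem_strict_part)
    then show "(rescaled_map p q \<phi> \<longlongrightarrow> rescaled_map p q \<phi> z) (at z within strict_part p X)"
      using rescaled_map_interior_limit[OF gc g(2), of z p q] z sub by (auto simp: mem_strict_part)
  qed
  then have cont: "continuous_map (subtopology euclidean (strict_part p X)) euclidean (rescaled_map p q \<phi>)"
    by simp
  have lim: "\<exists>l. (rescaled_map p q \<phi> \<longlongrightarrow> l) (at z within strict_part p X)"
    if "z \<in> strict_transf p X" for z
  proof (cases "snd z = 0")
    case True
    then show ?thesis using rescaled_map_boundary_limit[OF sa lip] by blast
  next
    case False
    then have "snd z > 0" using mem_strict_transf[OF that] by simp
    then show ?thesis using rescaled_map_interior_limit[OF gc g(2) that] by blast
  qed
  obtain H where "continuous_map (subtopology euclidean (strict_transf p X)) euclidean H"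
    "\<And>z. z \<in> strict_part p X \<Longrightarrow> H z = rescaled_map p q \<phi> z"
  proof (rule continuous_map_extension_pointwise_alt[OF _ sub _ cont])
    show "regular_space (euclidean :: 'b topology)" by (simp add: regular_space_euclidean)
    show "strict_transf p X \<subseteq> euclidean closure_of strict_part p X" by (simp add: strict_transf_def)
    show "\<exists>l. limitin euclidean (rescaled_map p q \<phi>) l (atin_within euclidean z (strict_part p X))"
      if "z \<in> strict_transf p X - strict_part p X" for z
      using lim[of z] that by (simp add: atin_within_euclidean)
  qed blast
  then show ?thesis by auto
qed

section \<open>Semialgebraic lipeomorphisms are blow-spherical\<close>

lemma lipschitz_pair_filterlim:
  assumes lip: "lipschitz_pair L X \<phi> p q" and lip': "lipschitz_pair L' Y \<psi> q p"
    and inv: "\<And>x. x \<in> X \<Longrightarrow> \<phi> x \<in> Y \<and> \<psi> (\<phi> x) = x"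
  shows "filterlim \<phi> (nhds_ext q) (inf (nhds_ext p) (principal X))"
proof (cases p)
  case (Some a)
  then obtain b where q: "q = Some b" using lip by (cases q) (auto simp: lipschitz_pair_def)
  have le: "norm (\<phi> x - b) \<le> L * norm (x - a)" if "x \<in> X" for x
    using lip that by (simp add: lipschitz_pair_def Some q)
  have "((\<lambda>x. L * norm (x - a)) \<longlongrightarrow> L * norm (a - a)) (nhds a)"
    by (intro tendsto_intros filterlim_ident)
  then have "((\<lambda>x. L * norm (x - a)) \<longlongrightarrow> 0) (inf (nhds a) (principal X))"
    by (simp add: tendsto_mono[OF inf_le1])
  then have "((\<lambda>x. \<phi> x - b) \<longlongrightarrow> 0) (inf (nhds a) (principal X))"
    by (rule Lim_null_comparison[rotated]) (use le in \<open>auto simp: eventually_inf_principal\<close>)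
  then show ?thesis by (simp add: nhds_ext_def Some q LIM_zero_iff)
next
  case None
  then have q: "q = None" using lip by (simp add: lipschitz_pair_def)
  have L': "L' \<ge> 0" using lip' lipschitz_on_nonneg unfolding lipschitz_pair_def by blast
  obtain C where C: "\<forall>y\<in>Y. \<forall>t>0. norm (rescale p t (\<psi> y)) \<le> L' * norm (rescale q t y) + C * t"
    using rescale_bound[OF lip'] by blast
  have le: "norm x \<le> (L' + 1) * norm (\<phi> x) + C" if "x \<in> X" for x
  proof -
    have "norm (rescale p 1 (\<psi> (\<phi> x))) \<le> L' * norm (rescale q 1 (\<phi> x)) + C * 1"
      using C inv[OF that] by (metis zero_less_one)
    then have "norm x \<le> L' * norm (\<phi> x) + C" using inv[OF that] by (simp add: rescale_def None q)
    also have "\<dots> \<le> (L' + 1) * norm (\<phi> x) + C" by (simp add: mult_right_mono)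
    finally show ?thesis .
  qed
  have "filterlim (\<lambda>x. norm (\<phi> x)) at_top (inf at_infinity (principal X))"
    unfolding filterlim_at_top
  proof
    fix Z :: real
    have "\<forall>\<^sub>F x::'a in at_infinity. (L' + 1) * Z + C \<le> norm x"
      using filterlim_norm_at_top by (auto simp: filterlim_at_top)
    then show "\<forall>\<^sub>F x in inf at_infinity (principal X). Z \<le> norm (\<phi> x)"
      unfolding eventually_inf_principal
    proof (rule eventually_mono, intro impI)
      fix x assume "(L' + 1) * Z + C \<le> norm x" "x \<in> X"
      then have "(L' + 1) * Z \<le> (L' + 1) * norm (\<phi> x)" using le by fastforce
      then show "Z \<le> norm (\<phi> x)" using L' by simp
    qed
  qed
  then show ?thesis
    by (simp add: nhds_ext_def None q filterlim_at_infinity_conv_norm_at_top)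
qed

text \<open>The rescaled inverse, evaluated at the image in the blow-up at \<open>q\<close>.\<close>

lemma rescaled_map_inverse:
  fixes X :: "'a::real_normed_vector set" and Y :: "'b::real_normed_vector set"
  assumes inv: "\<And>x. x \<in> X \<Longrightarrow> \<phi> x \<in> Y \<and> \<psi> (\<phi> x) = x" and pq: "p = None \<longleftrightarrow> q = None"
    and z: "z \<in> strict_part p X" and nz: "rescaled_map p q \<phi> z \<noteq> 0"
  defines "w \<equiv> (sgn (rescaled_map p q \<phi> z), blowup_radius q (snd z) (norm (rescaled_map p q \<phi> z)))"
  shows "w = sph_blowup_inv q (\<phi> (sph_blowup p z))" "w \<in> strict_part q Y"
    "rescaled_map q p \<psi> w = fst z /\<^sub>R norm (rescaled_map p q \<phi> z)"
proof -
  let ?x = "sph_blowup p z" and ?t = "snd z"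
  have x: "?x \<in> X" "?t > 0" using z by (auto simp: mem_strict_part)
  have nz': "rescale q ?t (\<phi> ?x) \<noteq> 0" using nz by (simp add: rescaled_map_def)
  then have rem: "\<phi> ?x \<noteq> removed_pt q" using rescale_eq_0_iff x(2) by blast
  show w: "w = sph_blowup_inv q (\<phi> ?x)"
    using sph_blowup_inv_rescale[OF x(2) nz'] by (simp add: w_def rescaled_map_def)
  then show "w \<in> strict_part q Y" using inv[OF x(1)] rem by (auto simp: strict_part_def)
  have "sph_blowup q w = \<phi> ?x" unfolding w by (rule sph_blowup_inv_props(3)[OF rem])
  then have "rescaled_map q p \<psi> w = rescale p (blowup_radius q ?t (norm (rescaled_map p q \<phi> z))) ?x"
    using inv[OF x(1)] by (simp add: rescaled_map_def w_def)
  also have "\<dots> = rescale p ?t ?x /\<^sub>R norm (rescaled_map p q \<phi> z)"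
    by (rule rescale_blowup_radius[OF x(2) nz pq])
  finally show "rescaled_map q p \<psi> w = fst z /\<^sub>R norm (rescaled_map p q \<phi> z)"
    by (simp add: rescale_sph_blowup[OF x(2)])
qed

text \<open>As the inverse map is Lipschitz, the limits of the rescaled map at the boundary do not
  vanish.\<close>

lemma rescaled_map_boundary_nonzero:
  fixes X :: "'a::real_normed_vector set" and Y :: "'b::real_normed_vector set"
  assumes inv: "\<And>x. x \<in> X \<Longrightarrow> \<phi> x \<in> Y \<and> \<psi> (\<phi> x) = x" and lip': "lipschitz_pair L' Y \<psi> q p"
    and H: "continuous_on (strict_transf p X) H" "\<And>z. z \<in> strict_part p X \<Longrightarrow> H z = rescaled_map p q \<phi> z"
    and z: "z \<in> strict_bd p X"
  shows "H z \<noteq> 0"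
proof -
  obtain C where C: "\<forall>y\<in>Y. \<forall>t>0. norm (rescale p t (\<psi> y)) \<le> L' * norm (rescale q t y) + C * t"
    using rescale_bound[OF lip'] by blast
  have "1 \<le> L' * norm (H z) + C * snd z" if "z \<in> strict_part p X" for z
  proof -
    have x: "sph_blowup p z \<in> X" "snd z > 0" "norm (fst z) = 1"
      using that by (auto simp: mem_strict_part)
    have "norm (rescale p (snd z) (\<psi> (\<phi> (sph_blowup p z)))) \<le>
        L' * norm (rescale q (snd z) (\<phi> (sph_blowup p z))) + C * snd z"
      using C inv[OF x(1)] x(2) by blast
    then show ?thesis
      using inv[OF x(1)] x rescale_sph_blowup[OF x(2), of p] H(2)[OF that] by (simp add: rescaled_map_def)
  qed
  moreover have "continuous_on (closure (strict_part p X)) (\<lambda>z. L' * norm (H z) + C * snd z)"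
    using H(1) unfolding strict_transf_def by (intro continuous_intros)
  moreover have "z \<in> closure (strict_part p X)" "snd z = 0"
    using z by (auto simp: strict_bd_def strict_transf_def)
  ultimately have "1 \<le> L' * norm (H z) + C * snd z"
    using continuous_ge_on_closure[of "strict_part p X" "\<lambda>z. L' * norm (H z) + C * snd z" z 1] by blast
  then show ?thesis using \<open>snd z = 0\<close> by auto
qed

lemma blow_spherical_at_of_lipschitz_pair:
  fixes X :: "'a::euclidean_space set" and Y :: "'b::euclidean_space set"
  assumes sa: "semialgebraic_map_on X \<phi>" "semialgebraic_map_on Y \<psi>"
    and lip: "lipschitz_pair L X \<phi> p q" and lip': "lipschitz_pair L' Y \<psi> q p"
    and inv: "\<And>x. x \<in> X \<Longrightarrow> \<phi> x \<in> Y \<and> \<psi> (\<phi> x) = x" and inv': "\<And>y. y \<in> Y \<Longrightarrow> \<psi> y \<in> X \<and> \<phi> (\<psi> y) = y"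
    and hom: "homeomorphism X Y \<phi> \<psi>" and p: "in_ext_closure p X"
  shows "blow_spherical_at X Y \<phi> p q"
proof -
  have pq: "p = None \<longleftrightarrow> q = None" using lip by (simp add: lipschitz_pair_def)
  obtain H where H: "continuous_on (strict_transf p X) H"
    "\<And>z. z \<in> strict_part p X \<Longrightarrow> H z = rescaled_map p q \<phi> z"
    using rescaled_map_extension[OF sa(1) lip] by blast
  obtain H' where H': "continuous_on (strict_transf q Y) H'"
    "\<And>z. z \<in> strict_part q Y \<Longrightarrow> H' z = rescaled_map q p \<psi> z"
    using rescaled_map_extension[OF sa(2) lip'] by blast
  define U where "U = {z \<in> closure (strict_part p X). H z \<noteq> 0}"
  define V where "V = {z \<in> closure (strict_part q Y). H' z \<noteq> 0}"
  define \<Phi> where "\<Phi> z = (sgn (H z), blowup_radius q (snd z) (norm (H z)))" for z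
  define \<Psi> where "\<Psi> z = (sgn (H' z), blowup_radius p (snd z) (norm (H' z)))" for z
  have \<Phi>: "\<Phi> z = sph_blowup_inv q (\<phi> (sph_blowup p z))" "\<Phi> z \<in> strict_part q Y"
      "H' (\<Phi> z) = fst z /\<^sub>R norm (H z)" if "z \<in> strict_part p X" "H z \<noteq> 0" for z
    using rescaled_map_inverse[OF inv pq that(1)] that H(2)[OF that(1)] H'(2)[of "\<Phi> z"]
    by (simp_all add: \<Phi>_def)
  have \<Psi>: "\<Psi> z \<in> strict_part p X" "H (\<Psi> z) = fst z /\<^sub>R norm (H' z)"
    if "z \<in> strict_part q Y" "H' z \<noteq> 0" for z
    using rescaled_map_inverse[OF inv' pq[symmetric] that(1)] that H'(2)[OF that(1)] H(2)[of "\<Psi> z"]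
    by (simp_all add: \<Psi>_def)
  note c = H(1)[unfolded strict_transf_def] and c' = H'(1)[unfolded strict_transf_def]
  have AB: "\<forall>z\<in>strict_part p X. H z \<noteq> 0 \<longrightarrow> \<Phi> z \<in> strict_part q Y \<and> H' (\<Phi> z) = fst z /\<^sub>R norm (H z)"
    using \<Phi> by blast
  have BA: "\<forall>z\<in>strict_part q Y. H' z \<noteq> 0 \<longrightarrow> \<Psi> z \<in> strict_part p X \<and> H (\<Psi> z) = fst z /\<^sub>R norm (H' z)"
    using \<Psi> by blast
  have n: "norm (fst z) = 1" if "z \<in> closure (strict_part p X)" for z
    using mem_strict_transf that unfolding strict_transf_def by blast
  have n': "norm (fst z) = 1" if "z \<in> closure (strict_part q Y)" for z
    using mem_strict_transf that unfolding strict_transf_def by blast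
  have homeo: "homeomorphism U V \<Phi> \<Psi>" "\<Phi> ` (U \<inter> strict_part p X) = V \<inter> strict_part q Y"
    using blowup_homeomorphism[OF c c' pq n n' AB[unfolded \<Phi>_def] BA[unfolded \<Psi>_def]]
    by (simp_all add: U_def V_def \<Phi>_def[abs_def] \<Psi>_def[abs_def])
  have "openin (top_of_set (strict_transf p X)) U"
    using blowup_extension(1)[OF c c' AB[unfolded \<Phi>_def]] by (simp add: U_def strict_transf_def)
  moreover have "openin (top_of_set (strict_transf q Y)) V"
    using blowup_extension(1)[OF c' c BA[unfolded \<Psi>_def]] by (simp add: V_def strict_transf_def)
  moreover have "strict_bd p X \<subseteq> U"
  proof
    fix z assume z: "z \<in> strict_bd p X"
    have "H z \<noteq> 0" by (rule rescaled_map_boundary_nonzero[OF inv lip' H z])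
    then show "z \<in> U" using z by (simp add: U_def strict_bd_def strict_transf_def)
  qed
  moreover have "strict_bd q Y \<subseteq> V"
  proof
    fix z assume z: "z \<in> strict_bd q Y"
    have "H' z \<noteq> 0" by (rule rescaled_map_boundary_nonzero[OF inv' lip H' z])
    then show "z \<in> V" using z by (simp add: V_def strict_bd_def strict_transf_def)
  qed
  moreover have "\<forall>z\<in>U \<inter> strict_part p X. \<Phi> z = (sph_blowup_inv q \<circ> \<phi> \<circ> sph_blowup p) z"
    using \<Phi>(1) by (simp add: U_def)
  ultimately show ?thesis
    unfolding blow_spherical_at_def using hom p homeo lipschitz_pair_filterlim[OF lip lip' inv] by blast
qed

lemma semialgebraic_map_on_inverse:
  fixes \<phi> :: "'a::euclidean_space \<Rightarrow> 'b::euclidean_space"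
  assumes "semialgebraic_map_on X \<phi>"
    and inv: "\<And>x. x \<in> X \<Longrightarrow> \<phi> x \<in> Y \<and> \<psi> (\<phi> x) = x" and inv': "\<And>y. y \<in> Y \<Longrightarrow> \<psi> y \<in> X \<and> \<phi> (\<psi> y) = y"
  shows "semialgebraic_map_on Y \<psi>"
proof -
  have "polynomial_function (\<lambda>z :: 'b \<times> 'a. (snd z, fst z))"
    by (intro polynomial_function_bounded_linear bounded_linear_Pair bounded_linear_snd bounded_linear_fst)
  with assms(1) have "semialgebraic ((\<lambda>z. (snd z, fst z)) -` ((\<lambda>x. (x, \<phi> x)) ` X))"
    unfolding semialgebraic_map_on_def by (rule semialgebraic_vimage)
  moreover have "(\<lambda>z. (snd z, fst z)) -` ((\<lambda>x. (x, \<phi> x)) ` X) = (\<lambda>y. (y, \<psi> y)) ` Y"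
    using inv inv' by (force simp: image_iff)
  ultimately show ?thesis by (simp add: semialgebraic_map_on_def)
qed

text \<open>The point \<open>q\<close> is the value at \<open>p\<close> of the continuous extension, or \<open>\<infinity>\<close> for \<open>p = \<infinity>\<close>.\<close>

lemma lipschitz_pair_extension:
  fixes \<phi> :: "'a::euclidean_space \<Rightarrow> 'b::euclidean_space"
  assumes lip: "L-lipschitz_on X \<phi>" and lip': "L'-lipschitz_on Y \<psi>"
    and inv: "\<And>x. x \<in> X \<Longrightarrow> \<phi> x \<in> Y \<and> \<psi> (\<phi> x) = x" and inv': "\<And>y. y \<in> Y \<Longrightarrow> \<psi> y \<in> X \<and> \<phi> (\<psi> y) = y"
    and p: "in_ext_closure p X"
  shows "\<exists>q. lipschitz_pair L X \<phi> p q \<and> lipschitz_pair L' Y \<psi> q p"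
proof (cases p)
  case None
  then have "lipschitz_pair L X \<phi> p None \<and> lipschitz_pair L' Y \<psi> None p"
    using lip lip' by (simp add: lipschitz_pair_def)
  then show ?thesis ..
next
  case (Some a)
  then have a: "a \<in> closure X" using p by (simp add: in_ext_closure_def)
  then obtain \<xi> where \<xi>: "\<And>n. \<xi> n \<in> X" "\<xi> \<longlonglongrightarrow> a" by (auto simp: closure_sequential)
  obtain g where g: "L-lipschitz_on (closure X) g" "\<And>x. x \<in> X \<Longrightarrow> g x = \<phi> x"
    using lipschitz_extend_closure[OF lip] by blast
  have "norm (\<phi> x - g a) \<le> L * norm (x - a)" if "x \<in> X" for x
    using lipschitz_onD[OF g(1), of x a] that a g(2)[OF that] closure_subset by (auto simp: dist_norm)
  then have 1: "lipschitz_pair L X \<phi> p (Some (g a))"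
    using lip by (simp add: lipschitz_pair_def Some)
  have "(\<lambda>n. g (\<xi> n)) \<longlonglongrightarrow> g a"
    by (rule continuous_on_tendsto_compose[OF lipschitz_on_continuous_on[OF g(1)] \<xi>(2) a])
       (use \<xi>(1) closure_subset in \<open>auto intro!: always_eventually\<close>)
  then have lim: "(\<lambda>n. \<phi> (\<xi> n)) \<longlonglongrightarrow> g a" using g(2) \<xi>(1) by simp
  have "norm (\<psi> y - a) \<le> L' * norm (y - g a)" if y: "y \<in> Y" for y
  proof (rule LIMSEQ_le)
    show "(\<lambda>n. norm (\<psi> y - \<xi> n)) \<longlonglongrightarrow> norm (\<psi> y - a)" by (intro tendsto_intros \<xi>(2))
    show "(\<lambda>n. L' * norm (y - \<phi> (\<xi> n))) \<longlonglongrightarrow> L' * norm (y - g a)" by (intro tendsto_intros lim)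
    have "norm (\<psi> y - \<xi> n) \<le> L' * norm (y - \<phi> (\<xi> n))" for n
      using lipschitz_onD[OF lip' y, of "\<phi> (\<xi> n)"] inv[OF \<xi>(1)] by (simp add: dist_norm)
    then show "\<exists>N. \<forall>n\<ge>N. norm (\<psi> y - \<xi> n) \<le> L' * norm (y - \<phi> (\<xi> n))" by blast
  qed
  then have "lipschitz_pair L' Y \<psi> (Some (g a)) p"
    using lip' by (simp add: lipschitz_pair_def Some)
  with 1 show ?thesis by blast
qed

theorem proposition3p12:
  fixes X :: "(real ^ 'n) set" and Y :: "(real ^ 'm) set" and h :: "real ^ 'n \<Rightarrow> real ^ 'm"
  assumes "semialgebraic X" and "semialgebraic Y"
    and "semialgebraic_map_on X h"
    and "outer_lipeomorphism X Y h"
  shows "blow_spherical_homeomorphism X Y h"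
proof -
  define \<psi> where "\<psi> = the_inv_into X h"
  obtain L L' where bij: "bij_betw h X Y" and L: "L-lipschitz_on X h" and L': "L'-lipschitz_on Y \<psi>"
    using assms(4) by (auto simp: outer_lipeomorphism_def \<psi>_def)
  have inv: "h x \<in> Y \<and> \<psi> (h x) = x" if "x \<in> X" for x
    using bij that by (auto simp: \<psi>_def bij_betw_def the_inv_into_f_f)
  have inv': "\<psi> y \<in> X \<and> h (\<psi> y) = y" if "y \<in> Y" for y
    using bij_betw_the_inv_into[OF bij] f_the_inv_into_f_bij_betw[OF bij] that
    by (auto simp: \<psi>_def bij_betw_def)
  have hom: "homeomorphism X Y h \<psi>"
    using L L' inv inv' by (intro homeomorphismI lipschitz_on_continuous_on) auto
  have sa: "semialgebraic_map_on Y \<psi>"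
    by (rule semialgebraic_map_on_inverse[OF assms(3) inv inv'])
  have "\<exists>q. blow_spherical_at X Y h p q" if p: "in_ext_closure p X" for p
  proof -
    obtain q where "lipschitz_pair L X h p q" "lipschitz_pair L' Y \<psi> q p"
      using lipschitz_pair_extension[OF L L' inv inv' p] by blast
    then have "blow_spherical_at X Y h p q"
      using blow_spherical_at_of_lipschitz_pair[OF assms(3) sa _ _ inv inv' hom p] by blast
    then show ?thesis ..
  qed
  then show ?thesis unfolding blow_spherical_homeomorphism_def using hom by blast
qed

end
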